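(* Let $n \geq 1$ and let $\gamma$ be the standard Gaussian measure on $\mathbb{R}^n$. For all Borel probability measures $\mu,\nu$ on $\mathbb{R}^n$ with finite second moments and with $\mu$ centered (i.e., $\int_{\mathbb{R}^n} x \, d\mu(x) = 0$), $$W_2(\mu,\nu)^2 \leq 2 D(\mu\|\gamma) + 2 D(\nu\|\gamma).$$
   Context: $W_2$ is the 2-Wasserstein distance: $W_2(\mu,\nu)^2 = \inf \mathbb{E}\|X-Y\|^2$, the infimum being over all couplings $(X,Y)$ with $X\sim\mu$, $Y\sim\nu$, where $\|\cdot\|$ is the Euclidean norm (no factor $1/2$). $D(\mu\|\gamma)\in[0,\infty]$ is the relative entropy: $D(\mu\|\gamma) = \int \log\frac{d\mu}{d\gamma}\, d\mu$ (natural logarithm) if $\mu$ is absolutely continuous with respect to $\gamma$, and $+\infty$ otherwise. The standard Gaussian measure $\gamma$ is $N(0,\mathrm{I})$, with density $(2\pi)^{-n/2}e^{-\|x\|^2/2}$. *)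

theory Defs
  imports "HOL-Probability.Probability"
begin

definition std_gaussian :: "(real ^ 'n) measure" where
  "std_gaussian = density lborel
     (\<lambda>x. ennreal ((2 * pi) powr (- real CARD('n) / 2) * exp (- (norm x)\<^sup>2 / 2)))"

text \<open>A coupling \<open>(X, Y)\<close> of \<open>M\<close> and \<open>N\<close> is represented by its joint law.\<close>

definition couplings ::
  "'a::euclidean_space measure \<Rightarrow> 'a measure \<Rightarrow> ('a \<times> 'a) measure set" where
  "couplings M N = {P. prob_space P \<and> sets P = sets (borel \<Otimes>\<^sub>M borel)
     \<and> distr P borel fst = M \<and> distr P borel snd = N}"

definition transport_cost2 :: "'a::euclidean_space measure \<Rightarrow> 'a measure \<Rightarrow> ennreal" where
  "transport_cost2 M N =
     (INF P\<in>couplings M N. \<integral>\<^sup>+ (x, y). ennreal ((norm (x - y))\<^sup>2) \<partial>P)"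

definition W2 :: "'a::euclidean_space measure \<Rightarrow> 'a measure \<Rightarrow> ereal" where
  "W2 M N = (if transport_cost2 M N = \<infinity> then \<infinity>
             else ereal (sqrt (enn2real (transport_cost2 M N))))"

text \<open>The entropy of \<open>M\<close> relative to \<open>G\<close>, for probability measures on the same
  \<open>\<sigma>\<close>-algebra. The library's \<open>KL_divergence b G M\<close> is the Bochner integral
  of \<open>log b (dM/dG)\<close> against \<open>M\<close>, and so takes the value \<open>0\<close> when the
  integrand is not integrable. The negative part is always integrable
  (as \<open>t * log t \<ge> - 1 / exp 1\<close>), hence non-integrability means that the
  integral is \<open>\<infinity>\<close>.\<close>

definition relative_entropy :: "'a measure \<Rightarrow> 'a measure \<Rightarrow> ereal" where
  "relative_entropy M G =
     (if absolutely_continuous G M \<and> integrable M (entropy_density (exp 1) G M)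
      then ereal (KL_divergence (exp 1) G M) else \<infinity>)"

end

theory Submission
  imports Defs
begin

text \<open>
  Let \<open>\<mu>\<close> and \<open>\<nu>\<close> have finite entropy and let \<open>Z\<close> be a standard Gaussian vector. The Knothe maps
  \<open>S\<close> and \<open>T\<close> push \<open>Z\<close> to \<open>\<mu>\<close> and \<open>\<nu>\<close> one coordinate at a time, \<open>S\<close> in increasing and \<open>T\<close> in
  decreasing order of the coordinates. Then \<open>S\<^sub>i\<close> depends on \<open>Z\<^sub>1, \<dots>, Z\<^sub>i\<close> and \<open>T\<^sub>i\<close> on
  \<open>Z\<^sub>i, \<dots>, Z\<^sub>n\<close>, so that, given \<open>Z\<^sub>i\<close>, the two are independent, and the cost of the coupling
  \<open>(S Z, T Z)\<close> in the \<open>i\<close>-th coordinate is controlled by a one-dimensional inequality for the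
  conditional laws. Its error term is the product of the two conditional means; these are functions
  of disjoint sets of coordinates, so its expectation is \<open>E S\<^sub>i * E T\<^sub>i\<close>, which vanishes as \<open>\<mu>\<close> is
  centered. The chain rule adds up the conditional entropies to \<open>D(\<mu>\<parallel>\<gamma>)\<close> and \<open>D(\<nu>\<parallel>\<gamma>)\<close>.

  In dimension one, let \<open>F, G\<close> be the increasing maps from the Gaussian \<open>\<gamma>\<close> to the two laws. By
  Hoeffding's formula, \<open>Cov (F Z) (G Z) = E (F'(X) * G'(Y))\<close> for a coupling \<open>(X, Y)\<close> of \<open>\<gamma>\<close> with
  itself that does not depend on \<open>F\<close> and \<open>G\<close>, and \<open>t \<ge> 1 + ln t\<close> bounds this from below by
  \<open>1 + E (ln (F' Z)) + E (ln (G' Z))\<close>, which is an expression in the two entropies and second moments.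
\<close>

subsection \<open>The Gaussian distribution function\<close>

abbreviation "\<gamma> \<equiv> std_normal_distribution"
abbreviation "\<Phi> \<equiv> cdf std_normal_distribution"

interpretation \<gamma>: real_distribution \<gamma>
  by (rule real_dist_normal_dist)

lemma emeasure_std_normal_pos:
  assumes "A \<in> sets borel" "emeasure lborel A > 0"
  shows "measure \<gamma> A > 0"
proof -
  have "emeasure \<gamma> A \<noteq> 0"
  proof
    assume "emeasure \<gamma> A = 0"
    then have "A \<in> null_sets \<gamma>" using assms by auto
    then have "AE x in lborel. x \<in> A \<longrightarrow> std_normal_density x = 0"
      by (subst (asm) null_sets_density_iff) auto
    then have "AE x in lborel. x \<notin> A" by (simp add: normal_density_pos less_imp_neq[symmetric])
    then have "emeasure lborel A = 0" using AE_iff_measurable[of A lborel "\<lambda>x. x \<notin> A"] assms by auto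
    with assms show False by simp
  qed
  then show ?thesis by (simp add: \<gamma>.emeasure_eq_measure zero_less_measure_iff)
qed

lemma Phi_strict_mono: "x < y \<Longrightarrow> \<Phi> x < \<Phi> y"
proof -
  assume "x < y"
  then have "measure \<gamma> {x<..y} > 0" by (intro emeasure_std_normal_pos) auto
  then show ?thesis using \<gamma>.cdf_diff_eq[OF \<open>x < y\<close>] by simp
qed

lemma Phi_le_iff: "\<Phi> x \<le> \<Phi> y \<longleftrightarrow> x \<le> y"
  using Phi_strict_mono[of x y] Phi_strict_mono[of y x] by (cases x y rule: linorder_cases) auto

lemma Phi_pos: "0 < \<Phi> x"
  using Phi_strict_mono[of "x - 1" x] \<gamma>.cdf_nonneg[of "x - 1"] by linarith

lemma Phi_less_one: "\<Phi> x < 1"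
  using Phi_strict_mono[of x "x + 1"] \<gamma>.cdf_bounded_prob[of "x + 1"] by linarith

lemma density_lborel_singleton:
  fixes h :: "real \<Rightarrow> ennreal"
  assumes [measurable]: "h \<in> borel_measurable borel"
  shows "measure (density lborel h) {x} = 0"
proof -
  have "emeasure (density lborel h) {x} = 0"
    using AE_lborel_singleton[of x]
    by (subst emeasure_density) (auto simp: nn_integral_0_iff_AE split: split_indicator)
  then show ?thesis by (simp add: measure_def)
qed

lemma isCont_Phi: "isCont \<Phi> x"
  by (subst \<gamma>.isCont_cdf) (rule density_lborel_singleton, simp)

lemma borel_measurable_Phi [measurable]: "\<Phi> \<in> borel_measurable borel"
  by (intro borel_measurable_continuous_onI continuous_at_imp_continuous_on) (simp add: isCont_Phi)

lemma Phi_surj: assumes "0 < a" "a < 1" obtains x where "\<Phi> x = a"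
proof -
  obtain l where l: "\<Phi> l < a"
    using order_tendstoD(2)[OF \<gamma>.cdf_lim_at_bot assms(1)] by (auto dest: eventually_happens'[OF trivial_limit_at_bot_linorder])
  obtain u where u: "a < \<Phi> u"
    using order_tendstoD(1)[OF \<gamma>.cdf_lim_at_top_prob assms(2)] by (auto dest: eventually_happens'[OF trivial_limit_at_top_linorder])
  have "l \<le> u" using Phi_le_iff[of l u] l u by linarith
  then have "\<exists>x. l \<le> x \<and> x \<le> u \<and> \<Phi> x = a"
    using l u by (intro IVT) (auto simp: isCont_Phi)
  then show ?thesis using that by blast
qed

text \<open>If \<open>Z\<close> has law \<open>\<gamma>\<close>, then \<open>\<Phi> Z\<close> is
  uniform on the unit interval: the event is a half-line ending where \<open>\<Phi>\<close> takes
  the value \<open>a\<close>. The endpoints are separate cases because \<open>\<Phi>\<close> attains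
  neither 0 nor 1.\<close>

lemma prob_Phi_le:
  assumes "0 \<le> a" "a \<le> 1"
  shows "emeasure \<gamma> {z. \<Phi> z \<le> a} = ennreal a"
proof -
  consider "a = 0" | "a = 1" | "0 < a" "a < 1" using assms by linarith
  then show ?thesis
  proof cases
    case 1
    then have "{z. \<Phi> z \<le> a} = {}" using Phi_pos by (auto simp: not_le)
    then show ?thesis using 1 by simp
  next
    case 2
    then have "{z. \<Phi> z \<le> a} = UNIV" using \<gamma>.cdf_bounded_prob by auto
    then show ?thesis using 2 \<gamma>.emeasure_space_1 by simp
  next
    case 3
    then obtain x where x: "\<Phi> x = a" using Phi_surj by blast
    then have "{z. \<Phi> z \<le> a} = {..x}" using Phi_le_iff by auto
    then show ?thesis using x by (simp add: cdf_def2 \<gamma>.emeasure_eq_measure)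
  qed
qed

lemma prob_Phi_greater:
  assumes "0 \<le> a" "a \<le> 1"
  shows "emeasure \<gamma> {z. a < \<Phi> z} = ennreal (1 - a)"
proof -
  have "emeasure \<gamma> (space \<gamma> - {z. \<Phi> z \<le> a}) = 1 - ennreal a"
    using prob_Phi_le[OF assms] by (subst emeasure_compl) (use \<gamma>.emeasure_space_1 in auto)
  moreover have "space \<gamma> - {z. \<Phi> z \<le> a} = {z. a < \<Phi> z}" by auto
  ultimately show ?thesis using assms by (simp add: ennreal_minus[symmetric])
qed

lemma std_normal_integrable: "integrable \<gamma> (\<lambda>z. z)" "integrable \<gamma> (\<lambda>z. z\<^sup>2)"
  and std_normal_mean: "(\<integral>z. z \<partial>\<gamma>) = 0"
  and std_normal_second_moment: "(\<integral>z. z\<^sup>2 \<partial>\<gamma>) = 1"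
  using integrable_std_normal_moment[of 1] integrable_std_normal_moment[of 2]
    integral_std_normal_moment_odd[of 0] integral_std_normal_moment_even[of 1]
  by (auto simp: integrable_density integral_density)

text \<open>The derivative of \<open>std_normal_density z\<close> is
  \<open>- z * std_normal_density z\<close>, so the negated density is an antiderivative of the
  integrand, and it vanishes at infinity.\<close>

lemma std_normal_tail_mean: "(\<integral>z. indicator {x<..} z * z \<partial>\<gamma>) = std_normal_density x"
proof -
  have *: "(LBINT z=ereal x..\<infinity>. z * std_normal_density z) = 0 - (- std_normal_density x)"
  proof (rule interval_integral_FTC_integrable[where F = "\<lambda>z. - std_normal_density z"])
    show "((\<lambda>z. - std_normal_density z) has_vector_derivative z * std_normal_density z) (at z)" for z
      unfolding std_normal_density_def has_real_derivative_iff_has_vector_derivative[symmetric]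
      by (auto intro!: derivative_eq_intros simp: field_simps)
    show "isCont (\<lambda>z. z * std_normal_density z) z" for z
      unfolding std_normal_density_def by (intro continuous_intros) auto
    show "set_integrable lborel (einterval (ereal x) \<infinity>) (\<lambda>z. z * std_normal_density z)"
      unfolding set_integrable_def using integrable_std_normal_moment[of 1]
      by (intro integrable_mult_indicator) (auto simp: mult.commute)
    have "isCont (\<lambda>z. - std_normal_density z) x"
      unfolding std_normal_density_def by (intro continuous_intros) auto
    then show "(((\<lambda>z. - std_normal_density z) \<circ> real_of_ereal) \<longlongrightarrow> - std_normal_density x) (at_right (ereal x))"
      by (simp add: ereal_tendsto_simps isCont_def tendsto_within_subset)
        (metis filterlim_at_split)
    have "((\<lambda>z. - std_normal_density z) \<longlongrightarrow> 0) at_top"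
      unfolding std_normal_density_def by real_asymp
    then show "(((\<lambda>z. - std_normal_density z) \<circ> real_of_ereal) \<longlongrightarrow> 0) (at_left \<infinity>)"
      by (simp add: ereal_tendsto_simps)
  qed auto
  have "(\<integral>z. indicator {x<..} z * z \<partial>\<gamma>) = (\<integral>z. indicator {x<..} z * (z * std_normal_density z) \<partial>lborel)"
    by (subst integral_density) (auto simp: mult_ac)
  then show ?thesis using * by (simp add: interval_lebesgue_integral_def set_lebesgue_integral_def)
qed

subsection \<open>Hoeffding's covariance formula\<close>

text \<open>
  The covariance kernel of the Brownian bridge, \<open>min a b - a * b\<close>, written as the probability that
  \<open>U \<le> min a b\<close> and \<open>V > max a b\<close> for independent uniform \<open>U, V\<close>.
\<close>

definition bridge_kernel :: "real \<Rightarrow> real \<Rightarrow> real" where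
  "bridge_kernel a b = min a b * (1 - max a b)"

lemma bridge_kernel_measurable [measurable (raw)]:
  assumes [measurable]: "f \<in> borel_measurable M" "g \<in> borel_measurable M"
  shows "(\<lambda>x. bridge_kernel (f x) (g x)) \<in> borel_measurable M"
  unfolding bridge_kernel_def by measurable

lemma bridge_kernel_commute: "bridge_kernel a b = bridge_kernel b a"
  by (simp add: bridge_kernel_def min.commute max.commute)

lemma bridge_kernel_nonneg: "0 \<le> a \<Longrightarrow> a \<le> 1 \<Longrightarrow> 0 \<le> b \<Longrightarrow> b \<le> 1 \<Longrightarrow> 0 \<le> bridge_kernel a b"
  by (simp add: bridge_kernel_def)

text \<open>The factors can also be grouped by parameter: those with \<open>a\<close> say that
  \<open>a\<close> separates \<open>\<Phi> u\<close> from \<open>\<Phi> v\<close>, and those with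
  \<open>b\<close> say the same of \<open>b\<close>. With \<open>a = A s\<close> and
  \<open>b = B t\<close>, the integrals over \<open>s\<close> and \<open>t\<close> can then be taken
  independently of each other.\<close>

lemma bridge_kernel_eq_nn_integral:
  assumes "0 \<le> a" "a \<le> 1" "0 \<le> b" "b \<le> 1"
  shows "ennreal (bridge_kernel a b) =
    (\<integral>\<^sup>+u. \<integral>\<^sup>+v. indicator {u. \<Phi> u \<le> a} u * indicator {u. \<Phi> u \<le> b} u *
       (indicator {v. a < \<Phi> v} v * indicator {v. b < \<Phi> v} v) \<partial>\<gamma> \<partial>\<gamma>)" (is "_ = ?R")
proof -
  have "?R = (\<integral>\<^sup>+u. \<integral>\<^sup>+v. indicator {u. \<Phi> u \<le> min a b} u *
       indicator {v. max a b < \<Phi> v} v \<partial>\<gamma> \<partial>\<gamma>)"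
    by (intro nn_integral_cong) (auto split: split_indicator)
  also have "\<dots> = (\<integral>\<^sup>+u. indicator {u. \<Phi> u \<le> min a b} u * ennreal (1 - max a b) \<partial>\<gamma>)"
    using assms prob_Phi_greater[of "max a b"]
    by (simp add: nn_integral_cmult del: max_less_iff_conj min.bounded_iff)
  also have "\<dots> = ennreal (min a b) * ennreal (1 - max a b)"
    using assms prob_Phi_le[of "min a b"]
    by (simp add: nn_integral_multc del: max_less_iff_conj min.bounded_iff)
  finally show ?thesis
    using assms by (simp add: bridge_kernel_def ennreal_mult)
qed

interpretation \<gamma>\<gamma>: pair_prob_space \<gamma> \<gamma> ..
interpretation l\<gamma>: pair_sigma_finite lborel \<gamma> ..

text \<open>By the equivalence, \<open>s\<close> contributes exactly when
  \<open>F u \<le> s < F v\<close>. The integral is the length of this interval, and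
  \<open>ennreal\<close> truncates the difference to 0 when \<open>F v < F u\<close>.\<close>

lemma nn_integral_indicator_between:
  fixes F p :: "'a \<Rightarrow> real" and A :: "real \<Rightarrow> real"
  assumes "\<And>z s. F z \<le> s \<longleftrightarrow> p z \<le> A s"
  shows "(\<integral>\<^sup>+s. indicator {u. p u \<le> A s} u * indicator {v. A s < p v} v \<partial>lborel) = ennreal (F v - F u)"
proof -
  have "(\<integral>\<^sup>+s. indicator {u. p u \<le> A s} u * indicator {v. A s < p v} v \<partial>lborel)
      = (\<integral>\<^sup>+s. indicator {F u ..< F v} s \<partial>lborel)"
  proof (intro nn_integral_cong)
    fix s show "indicator {u. p u \<le> A s} u * indicator {v. A s < p v} v = (indicator {F u ..< F v} s :: ennreal)"
      using assms[of u s] assms[of v s] by (auto split: split_indicator)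
  qed
  also have "\<dots> = ennreal (F v - F u)"
    by (cases "F u \<le> F v") (auto simp: ennreal_neg)
  finally show ?thesis .
qed

text \<open>Tonelli's theorem: the kernel is written as an integral over \<open>u\<close> and
  \<open>v\<close>, and the integrals over \<open>s\<close> and \<open>t\<close> are carried out
  first. Each of these gives the positive part of an increment.\<close>

lemma Hoeffding_nn:
  fixes F G A B :: "real \<Rightarrow> real"
  assumes F: "\<And>z s. F z \<le> s \<longleftrightarrow> \<Phi> z \<le> A s" and G: "\<And>z s. G z \<le> s \<longleftrightarrow> \<Phi> z \<le> B s"
    and A: "\<And>s. 0 \<le> A s" "\<And>s. A s \<le> 1" and B: "\<And>s. 0 \<le> B s" "\<And>s. B s \<le> 1"
    and [measurable]: "A \<in> borel_measurable borel" "B \<in> borel_measurable borel"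
  shows "(\<integral>\<^sup>+s. \<integral>\<^sup>+t. ennreal (bridge_kernel (A s) (B t)) \<partial>lborel \<partial>lborel) =
    (\<integral>\<^sup>+u. \<integral>\<^sup>+v. ennreal (F v - F u) * ennreal (G v - G u) \<partial>\<gamma> \<partial>\<gamma>)"
proof -
  define p :: "real \<Rightarrow> real \<Rightarrow> real \<Rightarrow> ennreal" where
    "p s u v = indicator {u. \<Phi> u \<le> A s} u * indicator {v. A s < \<Phi> v} v" for s u v
  define q :: "real \<Rightarrow> real \<Rightarrow> real \<Rightarrow> ennreal" where
    "q t u v = indicator {u. \<Phi> u \<le> B t} u * indicator {v. B t < \<Phi> v} v" for t u v
  have pI: "(\<integral>\<^sup>+s. p s u v \<partial>lborel) = ennreal (F v - F u)" for u v
    unfolding p_def by (rule nn_integral_indicator_between[OF F])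
  have qI: "(\<integral>\<^sup>+t. q t u v \<partial>lborel) = ennreal (G v - G u)" for u v
    unfolding q_def by (rule nn_integral_indicator_between[OF G])
  have p[measurable]: "(\<lambda>x. p (f x) (g x) (h x)) \<in> borel_measurable M"
    if [measurable]: "f \<in> borel_measurable M" "g \<in> borel_measurable M" "h \<in> borel_measurable M"
    for f g h and M :: "'x measure"
    unfolding p_def indicator_def mem_Collect_eq by measurable
  have q[measurable]: "(\<lambda>x. q (f x) (g x) (h x)) \<in> borel_measurable M"
    if [measurable]: "f \<in> borel_measurable M" "g \<in> borel_measurable M" "h \<in> borel_measurable M"
    for f g h and M :: "'x measure"
    unfolding q_def indicator_def mem_Collect_eq by measurable
  have "(\<integral>\<^sup>+s. \<integral>\<^sup>+t. ennreal (bridge_kernel (A s) (B t)) \<partial>lborel \<partial>lborel)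
      = (\<integral>\<^sup>+s. \<integral>\<^sup>+t. \<integral>\<^sup>+u. \<integral>\<^sup>+v. p s u v * q t u v \<partial>\<gamma> \<partial>\<gamma> \<partial>lborel \<partial>lborel)"
    unfolding p_def q_def
    by (intro nn_integral_cong, subst bridge_kernel_eq_nn_integral)
      (use A B in \<open>auto intro!: nn_integral_cong split: split_indicator\<close>)
  also have "\<dots> = (\<integral>\<^sup>+s. \<integral>\<^sup>+u. \<integral>\<^sup>+t. \<integral>\<^sup>+v. p s u v * q t u v \<partial>\<gamma> \<partial>lborel \<partial>\<gamma> \<partial>lborel)"
    by (intro nn_integral_cong l\<gamma>.Fubini'[symmetric]) measurable
  also have "\<dots> = (\<integral>\<^sup>+s. \<integral>\<^sup>+u. \<integral>\<^sup>+v. \<integral>\<^sup>+t. p s u v * q t u v \<partial>lborel \<partial>\<gamma> \<partial>\<gamma> \<partial>lborel)"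
    by (intro nn_integral_cong l\<gamma>.Fubini'[symmetric]) measurable
  also have "\<dots> = (\<integral>\<^sup>+s. \<integral>\<^sup>+u. \<integral>\<^sup>+v. p s u v * ennreal (G v - G u) \<partial>\<gamma> \<partial>\<gamma> \<partial>lborel)"
    by (simp add: nn_integral_cmult qI)
  finally have "(\<integral>\<^sup>+s. \<integral>\<^sup>+t. ennreal (bridge_kernel (A s) (B t)) \<partial>lborel \<partial>lborel) = \<dots>" .
  moreover have G_meas [measurable]: "G \<in> borel_measurable borel"
    using G by (simp add: borel_measurable_iff_le)
  moreover have "(\<integral>\<^sup>+s. \<integral>\<^sup>+u. \<integral>\<^sup>+v. p s u v * ennreal (G v - G u) \<partial>\<gamma> \<partial>\<gamma> \<partial>lborel)
      = (\<integral>\<^sup>+u. \<integral>\<^sup>+s. \<integral>\<^sup>+v. p s u v * ennreal (G v - G u) \<partial>\<gamma> \<partial>lborel \<partial>\<gamma>)"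
    by (intro l\<gamma>.Fubini'[symmetric]) measurable
  moreover have "\<dots> = (\<integral>\<^sup>+u. \<integral>\<^sup>+v. \<integral>\<^sup>+s. p s u v * ennreal (G v - G u) \<partial>lborel \<partial>\<gamma> \<partial>\<gamma>)"
    by (intro nn_integral_cong l\<gamma>.Fubini'[symmetric]) measurable
  moreover have "\<dots> = (\<integral>\<^sup>+u. \<integral>\<^sup>+v. ennreal (F v - F u) * ennreal (G v - G u) \<partial>\<gamma> \<partial>\<gamma>)"
    by (simp add: nn_integral_multc pI)
  ultimately show ?thesis by simp
qed

text \<open>Both partial integrals of \<open>(F v - F u) * (G v - G u)\<close> have this shape: over
  \<open>v\<close> with \<open>c = F u * G u\<close>, \<open>b = G u\<close> and
  \<open>a = F u\<close>, and afterwards over \<open>u\<close>, with the means of the product, of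
  \<open>G\<close> and of \<open>F\<close> in their places.\<close>

lemma (in prob_space)
  fixes F G :: "'a \<Rightarrow> real"
  assumes "integrable M F" "integrable M G" "integrable M (\<lambda>z. F z * G z)"
  shows integrable_bilinear: "integrable M (\<lambda>u. c - F u * b - G u * a + F u * G u)"
    and integral_bilinear: "(\<integral>u. c - F u * b - G u * a + F u * G u \<partial>M) =
      c - expectation F * b - expectation G * a + expectation (\<lambda>z. F z * G z)"
  using assms by (simp_all add: prob_space)

text \<open>For independent \<open>U\<close>, \<open>V\<close> with law \<open>\<gamma>\<close>, the
  mean of \<open>(F V - F U) * (G V - G U)\<close> is twice the covariance. As \<open>F\<close> and
  \<open>G\<close> are nondecreasing, the two increments never have opposite signs, so the positive
  parts in \<open>Hoeffding_nn\<close> account for one half of this mean.\<close>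

lemma Hoeffding_covariance:
  fixes F G A B :: "real \<Rightarrow> real"
  assumes F: "\<And>z s. F z \<le> s \<longleftrightarrow> \<Phi> z \<le> A s" and G: "\<And>z s. G z \<le> s \<longleftrightarrow> \<Phi> z \<le> B s"
    and A: "\<And>s. 0 \<le> A s" "\<And>s. A s \<le> 1" and B: "\<And>s. 0 \<le> B s" "\<And>s. B s \<le> 1"
    and [measurable]: "A \<in> borel_measurable borel" "B \<in> borel_measurable borel"
    and int: "integrable \<gamma> F" "integrable \<gamma> G" "integrable \<gamma> (\<lambda>z. F z * G z)"
  shows "(\<integral>\<^sup>+s. \<integral>\<^sup>+t. ennreal (bridge_kernel (A s) (B t)) \<partial>lborel \<partial>lborel) =
    ennreal ((\<integral>z. F z * G z \<partial>\<gamma>) - (\<integral>z. F z \<partial>\<gamma>) * (\<integral>z. G z \<partial>\<gamma>))" (is "?C = _")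
proof -
  have [measurable]: "F \<in> borel_measurable borel" "G \<in> borel_measurable borel"
    using F G by (simp_all add: borel_measurable_iff_le)
  define I where "I = (\<integral>z. F z * G z \<partial>\<gamma>) - (\<integral>z. F z \<partial>\<gamma>) * (\<integral>z. G z \<partial>\<gamma>)"
  have mono: "F u \<le> F v \<and> G u \<le> G v" if "u \<le> v" for u v
  proof
    have "\<Phi> u \<le> \<Phi> v" using that Phi_le_iff by blast
    moreover have "\<Phi> v \<le> A (F v)" "\<Phi> v \<le> B (G v)" using F G by blast+
    ultimately show "F u \<le> F v" "G u \<le> G v"
      using F[of u "F v"] G[of u "G v"] by linarith+
  qed
  have pos: "0 \<le> (F v - F u) * (G v - G u)" for u v
    using mono[of u v] mono[of v u] by (cases "u \<le> v") (auto intro!: mult_nonneg_nonneg mult_nonpos_nonpos)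
  have expand: "(F v - F u) * (G v - G u) = F u * G u - F v * G u - G v * F u + F v * G v" for u v
    by (simp add: algebra_simps)
  have inner: "(\<integral>v. (F v - F u) * (G v - G u) \<partial>\<gamma>) =
      (\<integral>z. F z * G z \<partial>\<gamma>) - F u * (\<integral>z. G z \<partial>\<gamma>) - G u * (\<integral>z. F z \<partial>\<gamma>) + F u * G u" for u
    unfolding expand \<gamma>.integral_bilinear[OF int] by simp
  have C: "?C = (\<integral>\<^sup>+u. \<integral>\<^sup>+v. ennreal (F v - F u) * ennreal (G v - G u) \<partial>\<gamma> \<partial>\<gamma>)"
    using F G A B by (intro Hoeffding_nn[where F=F and G=G and A=A and B=B]) simp_all
  also have "\<dots> = (\<integral>\<^sup>+v. \<integral>\<^sup>+u. ennreal (F v - F u) * ennreal (G v - G u) \<partial>\<gamma> \<partial>\<gamma>)"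
    by (intro \<gamma>\<gamma>.Fubini'[symmetric]) measurable
  finally have C': "?C = (\<integral>\<^sup>+u. \<integral>\<^sup>+v. ennreal (F u - F v) * ennreal (G u - G v) \<partial>\<gamma> \<partial>\<gamma>)" .
  \<comment> \<open>Exchanging the variables gives the contribution of the pairs with negative
    increments; the two integrands add up to the full product of the increments.\<close>
  have "?C + ?C = (\<integral>\<^sup>+u. \<integral>\<^sup>+v. ennreal (F v - F u) * ennreal (G v - G u)
      + ennreal (F u - F v) * ennreal (G u - G v) \<partial>\<gamma> \<partial>\<gamma>)"
  proof -
    have "(\<integral>\<^sup>+u. \<integral>\<^sup>+v. ennreal (F v - F u) * ennreal (G v - G u)
      + ennreal (F u - F v) * ennreal (G u - G v) \<partial>\<gamma> \<partial>\<gamma>) =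
      (\<integral>\<^sup>+u. (\<integral>\<^sup>+v. ennreal (F v - F u) * ennreal (G v - G u) \<partial>\<gamma>)
      + (\<integral>\<^sup>+v. ennreal (F u - F v) * ennreal (G u - G v) \<partial>\<gamma>) \<partial>\<gamma>)"
      by (intro nn_integral_cong nn_integral_add) measurable
    also have "\<dots> = (\<integral>\<^sup>+u. \<integral>\<^sup>+v. ennreal (F v - F u) * ennreal (G v - G u) \<partial>\<gamma> \<partial>\<gamma>)
      + (\<integral>\<^sup>+u. \<integral>\<^sup>+v. ennreal (F u - F v) * ennreal (G u - G v) \<partial>\<gamma> \<partial>\<gamma>)"
      by (intro nn_integral_add) measurable
    also have "\<dots> = ?C + ?C" by (simp only: C[symmetric] C'[symmetric])
    finally show ?thesis by simp
  qed
  also have "\<dots> = (\<integral>\<^sup>+u. \<integral>\<^sup>+v. ennreal ((F v - F u) * (G v - G u)) \<partial>\<gamma> \<partial>\<gamma>)"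
  proof (intro nn_integral_cong)
    fix u v show "ennreal (F v - F u) * ennreal (G v - G u) + ennreal (F u - F v) * ennreal (G u - G v)
      = ennreal ((F v - F u) * (G v - G u))"
    proof (cases "u \<le> v")
      case True
      with mono[of u v] show ?thesis by (simp add: ennreal_neg ennreal_mult)
    next
      case False
      moreover have "(F v - F u) * (G v - G u) = (F u - F v) * (G u - G v)" by (simp add: algebra_simps)
      ultimately show ?thesis using mono[of v u] by (simp add: ennreal_neg ennreal_mult)
    qed
  qed
  also have "\<dots> = (\<integral>\<^sup>+u. ennreal (\<integral>v. (F v - F u) * (G v - G u) \<partial>\<gamma>) \<partial>\<gamma>)"
  proof (intro nn_integral_cong nn_integral_eq_integral AE_I2 pos)
    fix u show "integrable \<gamma> (\<lambda>v. (F v - F u) * (G v - G u))"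
      unfolding expand by (rule \<gamma>.integrable_bilinear[OF int])
  qed
  also have "\<dots> = (\<integral>\<^sup>+u. ennreal ((\<integral>z. F z * G z \<partial>\<gamma>) - F u * (\<integral>z. G z \<partial>\<gamma>) - G u * (\<integral>z. F z \<partial>\<gamma>) + F u * G u) \<partial>\<gamma>)"
    by (intro nn_integral_cong arg_cong[where f=ennreal] inner)
  also have "\<dots> = ennreal (\<integral>u. (\<integral>z. F z * G z \<partial>\<gamma>) - F u * (\<integral>z. G z \<partial>\<gamma>) - G u * (\<integral>z. F z \<partial>\<gamma>) + F u * G u \<partial>\<gamma>)"
  proof (intro nn_integral_eq_integral AE_I2)
    fix u
    have "0 \<le> (\<integral>v. (F v - F u) * (G v - G u) \<partial>\<gamma>)" by (rule Bochner_Integration.integral_nonneg[OF pos])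
    also have "\<dots> = (\<integral>z. F z * G z \<partial>\<gamma>) - F u * (\<integral>z. G z \<partial>\<gamma>) - G u * (\<integral>z. F z \<partial>\<gamma>) + F u * G u"
      by (rule inner)
    finally show "0 \<le> \<dots>" .
    show "integrable \<gamma> (\<lambda>u. (\<integral>z. F z * G z \<partial>\<gamma>) - F u * (\<integral>z. G z \<partial>\<gamma>) - G u * (\<integral>z. F z \<partial>\<gamma>) + F u * G u)"
      by (rule \<gamma>.integrable_bilinear[OF int])
  qed
  also have "\<dots> = ennreal (2 * I)"
  proof -
    have "(\<integral>u. (\<integral>z. F z * G z \<partial>\<gamma>) - F u * (\<integral>z. G z \<partial>\<gamma>) - G u * (\<integral>z. F z \<partial>\<gamma>) + F u * G u \<partial>\<gamma>) = 2 * I"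
      unfolding \<gamma>.integral_bilinear[OF int] by (simp add: I_def)
    then show ?thesis by (rule arg_cong[where f=ennreal])
  qed
  finally have eq: "2 * ?C = ennreal (2 * I)" unfolding mult_2 .
  \<comment> \<open>The factor 2 is cancelled for nonnegative \<open>I\<close>. A negative
    \<open>I\<close> would be truncated to 0 by \<open>ennreal\<close> on both sides.\<close>
  show ?thesis
  proof (cases "0 \<le> I")
    case True
    then have "2 * ?C = 2 * ennreal I" using eq by (simp add: ennreal_mult)
    then show ?thesis unfolding I_def by (subst (asm) ennreal_mult_cancel_left) auto
  next
    case False
    then show ?thesis using eq unfolding I_def by (simp add: ennreal_neg)
  qed
qed

text \<open>This makes \<open>\<gamma>\<close> the marginal law of \<open>bridge_coupling\<close>.
  Integrating out \<open>y\<close> leaves the mean of \<open>v - u\<close> over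
  \<open>u \<le> x < v\<close> for independent Gaussian \<open>u\<close> and \<open>v\<close>. Both
  tail means are \<open>std_normal_density x\<close> up to sign, and their weights
  \<open>\<Phi> x\<close> and \<open>1 - \<Phi> x\<close> add up to 1.\<close>

lemma bridge_kernel_Phi_integral:
  "(\<integral>\<^sup>+y. ennreal (bridge_kernel (\<Phi> x) (\<Phi> y)) \<partial>lborel) = ennreal (std_normal_density x)"
proof -
  have pr: "measure \<gamma> {..x} = \<Phi> x" "measure \<gamma> {x<..} = 1 - \<Phi> x"
  proof -
    show 1: "measure \<gamma> {..x} = \<Phi> x" by (simp add: cdf_def2)
    have "{x<..} = space \<gamma> - {..x}" by auto
    then show "measure \<gamma> {x<..} = 1 - \<Phi> x" using \<gamma>.prob_compl[of "{..x}"] 1 by simp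
  qed
  have i: "integrable \<gamma> (\<lambda>v. indicator S v * v)" if "S \<in> sets borel" for S
    using integrable_mult_indicator[OF _ std_normal_integrable(1), of S] that by simp
  have i1: "integrable \<gamma> (indicator S :: real \<Rightarrow> real)" if "S \<in> sets borel" for S
    using that by (intro integrable_real_indicator) (auto simp: \<gamma>.emeasure_eq_measure)
  have inner: "integrable \<gamma> (\<lambda>v. indicator {..x} u * (indicator {x<..} v * v - indicator {x<..} v * u))"
    "(\<integral>v. indicator {..x} u * (indicator {x<..} v * v - indicator {x<..} v * u) \<partial>\<gamma>)
      = indicator {..x} u * std_normal_density x - (1 - \<Phi> x) * (indicator {..x} u * u)" for u
    by (cases "u \<le> x"; simp add: i i1 std_normal_tail_mean pr)+
  have outer: "integrable \<gamma> (\<lambda>u. indicator {..x} u * std_normal_density x - (1 - \<Phi> x) * (indicator {..x} u * u))"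
    by (intro Bochner_Integration.integrable_diff integrable_mult_right integrable_mult_left i i1) auto
  \<comment> \<open>The lower and the upper tail mean add up to the mean of \<open>\<gamma>\<close>,
    which is 0.\<close>
  have "(\<integral>u. indicator {..x} u * u + indicator {x<..} u * u \<partial>\<gamma>) = (\<integral>u. u \<partial>\<gamma>)"
    by (intro Bochner_Integration.integral_cong) (auto split: split_indicator)
  then have lo: "(\<integral>u. indicator {..x} u * u \<partial>\<gamma>) = - std_normal_density x"
    using i by (subst (asm) Bochner_Integration.integral_add)
      (auto simp: std_normal_mean std_normal_tail_mean)
  have "(\<integral>\<^sup>+y. ennreal (bridge_kernel (\<Phi> x) (\<Phi> y)) \<partial>lborel)
     = (\<integral>\<^sup>+y. \<integral>\<^sup>+u. \<integral>\<^sup>+v. indicator {..x} u * indicator {x<..} v * (indicator {u. u \<le> y} u * indicator {v. y < v} v) \<partial>\<gamma> \<partial>\<gamma> \<partial>lborel)"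
    using \<gamma>.cdf_bounded_prob \<gamma>.cdf_nonneg
    by (simp add: bridge_kernel_eq_nn_integral)
      (auto intro!: nn_integral_cong split: split_indicator simp: Phi_le_iff not_le[symmetric])
  also have "\<dots> = (\<integral>\<^sup>+u. \<integral>\<^sup>+y. \<integral>\<^sup>+v. indicator {..x} u * indicator {x<..} v * (indicator {u. u \<le> y} u * indicator {v. y < v} v) \<partial>\<gamma> \<partial>lborel \<partial>\<gamma>)"
    unfolding indicator_def mem_Collect_eq by (intro l\<gamma>.Fubini'[symmetric]) measurable
  also have "\<dots> = (\<integral>\<^sup>+u. \<integral>\<^sup>+v. \<integral>\<^sup>+y. indicator {..x} u * indicator {x<..} v * (indicator {u. u \<le> y} u * indicator {v. y < v} v) \<partial>lborel \<partial>\<gamma> \<partial>\<gamma>)"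
    unfolding indicator_def mem_Collect_eq by (intro nn_integral_cong l\<gamma>.Fubini'[symmetric]) measurable
  also have "\<dots> = (\<integral>\<^sup>+u. \<integral>\<^sup>+v. indicator {..x} u * indicator {x<..} v * ennreal (v - u) \<partial>\<gamma> \<partial>\<gamma>)"
  proof (intro nn_integral_cong)
    fix u v
    have "(\<integral>\<^sup>+y. indicator {..x} u * indicator {x<..} v * (indicator {u. u \<le> y} u * indicator {v. y < v} v) \<partial>lborel)
       = indicator {..x} u * indicator {x<..} v * (\<integral>\<^sup>+y. indicator {u. u \<le> y} u * indicator {v. y < v} v \<partial>lborel)"
      unfolding indicator_def mem_Collect_eq by (intro nn_integral_cmult) measurable
    then show "(\<integral>\<^sup>+y. indicator {..x} u * indicator {x<..} v * (indicator {u. u \<le> y} u * indicator {v. y < v} v) \<partial>lborel)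
       = indicator {..x} u * indicator {x<..} v * ennreal (v - u)"
      by (simp add: nn_integral_indicator_between[where F="\<lambda>x. x"])
  qed
  also have "\<dots> = (\<integral>\<^sup>+u. \<integral>\<^sup>+v. ennreal (indicator {..x} u * (indicator {x<..} v * v - indicator {x<..} v * u)) \<partial>\<gamma> \<partial>\<gamma>)"
    by (intro nn_integral_cong) (auto split: split_indicator)
  also have "\<dots> = (\<integral>\<^sup>+u. ennreal (\<integral>v. indicator {..x} u * (indicator {x<..} v * v - indicator {x<..} v * u) \<partial>\<gamma>) \<partial>\<gamma>)"
    by (intro nn_integral_cong nn_integral_eq_integral inner) (auto split: split_indicator)
  also have "\<dots> = (\<integral>\<^sup>+u. ennreal (indicator {..x} u * std_normal_density x - (1 - \<Phi> x) * (indicator {..x} u * u)) \<partial>\<gamma>)"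
    by (simp only: inner)
  also have "\<dots> = ennreal (\<integral>u. indicator {..x} u * std_normal_density x - (1 - \<Phi> x) * (indicator {..x} u * u) \<partial>\<gamma>)"
  proof (intro nn_integral_eq_integral AE_I2)
    fix u
    have "0 \<le> (\<integral>v. indicator {..x} u * (indicator {x<..} v * v - indicator {x<..} v * u) \<partial>\<gamma>)"
      by (intro integral_nonneg_AE) (auto split: split_indicator)
    also have "\<dots> = indicator {..x} u * std_normal_density x - (1 - \<Phi> x) * (indicator {..x} u * u)"
      by (rule inner)
    finally show "0 \<le> \<dots>" .
  qed (rule outer)
  also have "(\<integral>u. indicator {..x} u * std_normal_density x - (1 - \<Phi> x) * (indicator {..x} u * u) \<partial>\<gamma>) = std_normal_density x"
    by (simp add: i i1 lo pr) (simp add: algebra_simps)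
  finally show ?thesis .
qed

subsection \<open>The inequality on the line\<close>

text \<open>
  The affine correction makes the integrand of the entropy nonnegative without changing the integral
  for densities \<open>f\<close> of probability measures, so entropies can be handled as nonnegative integrals.
\<close>

definition entropy_fun :: "real \<Rightarrow> real" where
  "entropy_fun t = t * ln t - t + 1"

lemma entropy_fun_nonneg: "0 \<le> t \<Longrightarrow> 0 \<le> entropy_fun t"
proof (cases "t = 0")
  case False
  assume "0 \<le> t"
  with False have t: "t > 0" by simp
  then have "ln (1 / t) \<le> 1 / t - 1" by (intro ln_le_minus_one) simp
  then have "t * ln (1 / t) \<le> t * (1 / t - 1)" using t by (intro mult_left_mono) auto
  then show ?thesis using t by (simp add: entropy_fun_def ln_div algebra_simps)
qed (simp add: entropy_fun_def)

lemma entropy_fun_measurable [measurable (raw)]: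
  assumes [measurable]: "f \<in> borel_measurable M"
  shows "(\<lambda>x. entropy_fun (f x)) \<in> borel_measurable M"
  unfolding entropy_fun_def by measurable

definition rel_ent :: "'a measure \<Rightarrow> ('a \<Rightarrow> real) \<Rightarrow> ennreal" where
  "rel_ent M f = (\<integral>\<^sup>+x. ennreal (entropy_fun (f x)) \<partial>M)"

lemma (in prob_space)
  assumes [measurable]: "f \<in> borel_measurable M" and nonneg: "\<And>x. 0 \<le> f x"
    and total: "(\<integral>\<^sup>+x. ennreal (f x) \<partial>M) = 1" and fin: "rel_ent M f < \<infinity>"
  shows integrable_mult_ln: "integrable M (\<lambda>x. f x * ln (f x))"
    and integral_mult_ln: "(\<integral>x. f x * ln (f x) \<partial>M) = enn2real (rel_ent M f)"
proof -
  have f: "integrable M f"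
    using total nonneg by (intro integrableI_nonneg) auto
  have f1: "(\<integral>x. f x \<partial>M) = 1"
    using total nonneg by (subst integral_eq_nn_integral) auto
  have e: "integrable M (\<lambda>x. entropy_fun (f x))"
    using fin nonneg unfolding rel_ent_def by (intro integrableI_nonneg) (auto simp: entropy_fun_nonneg)
  have e1: "(\<integral>x. entropy_fun (f x) \<partial>M) = enn2real (rel_ent M f)"
    unfolding rel_ent_def using nonneg by (subst integral_eq_nn_integral) (auto simp: entropy_fun_nonneg)
  have eq: "f x * ln (f x) = entropy_fun (f x) + f x - 1" for x
    by (simp add: entropy_fun_def)
  show "integrable M (\<lambda>x. f x * ln (f x))" unfolding eq using e f by simp
  show "(\<integral>x. f x * ln (f x) \<partial>M) = enn2real (rel_ent M f)"
    unfolding eq using e f by (simp add: f1 e1 prob_space)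
qed

text \<open>This is the increasing transport map from \<open>\<gamma>\<close> to
  \<open>density \<gamma> c\<close>. A generalized inverse of the distribution function is taken
  because \<open>c\<close> may vanish on an interval, where that function is constant.\<close>

definition quantile :: "(real \<Rightarrow> real) \<Rightarrow> real \<Rightarrow> real" where
  "quantile c z = Inf {s. \<Phi> z \<le> cdf (density \<gamma> c) s}"

locale gauss_density =
  fixes c :: "real \<Rightarrow> real"
  assumes measurable_c [measurable]: "c \<in> borel_measurable borel"
    and nonneg: "0 \<le> c x"
    and total: "(\<integral>\<^sup>+x. ennreal (c x) \<partial>\<gamma>) = 1"
begin

abbreviation "M \<equiv> density \<gamma> c"

lemma real_distribution_M: "real_distribution M"
proof -
  have "prob_space M"
    by (rule prob_spaceI) (use total in \<open>simp add: emeasure_density\<close>)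
  then show ?thesis by (simp add: real_distribution_def real_distribution_axioms_def)
qed

sublocale M: cdf_distribution M
  unfolding cdf_distribution_def by (rule real_distribution_M)

lemma M_eq: "M = density lborel (\<lambda>x. ennreal (std_normal_density x * c x))"
  by (subst density_density_eq) (auto simp: ennreal_mult' nonneg)

lemma isCont_cdf_M: "isCont (cdf M) x"
  unfolding M.isCont_cdf by (subst M_eq) (rule density_lborel_singleton, simp)

text \<open>As \<open>\<Phi> z\<close> lies strictly between 0 and 1, the infimum is over a nonempty
  set that is bounded below, and right continuity makes it a minimum. All properties of
  \<open>quantile\<close> are derived from this equivalence.\<close>

lemma quantile_le_iff: "quantile c z \<le> s \<longleftrightarrow> \<Phi> z \<le> cdf M s"
  unfolding quantile_def by (rule M.pseudoinverse[symmetric]) (rule Phi_pos Phi_less_one)+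

lemma quantile_measurable [measurable]: "quantile c \<in> borel_measurable borel"
  by (simp add: borel_measurable_iff_le quantile_le_iff)

text \<open>A law with a Lebesgue density has no atoms, so its distribution function is continuous.
  Left of the quantile it is at most \<open>\<Phi> z\<close>, and this bound passes to the
  limit.\<close>

lemma cdf_quantile: "cdf M (quantile c z) = \<Phi> z"
proof (rule antisym)
  show "\<Phi> z \<le> cdf M (quantile c z)" by (simp add: quantile_le_iff[symmetric])
  have "(cdf M \<longlongrightarrow> cdf M (quantile c z)) (at_left (quantile c z))"
    using isCont_cdf_M by (simp add: isCont_def filterlim_at_split)
  moreover have "eventually (\<lambda>s. cdf M s \<le> \<Phi> z) (at_left (quantile c z))"
    unfolding eventually_at_left_field
  proof (intro exI[of _ "quantile c z - 1"] conjI allI impI)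
    fix s assume "s < quantile c z"
    then show "cdf M s \<le> \<Phi> z" using quantile_le_iff[of z s] by linarith
  qed simp
  ultimately show "cdf M (quantile c z) \<le> \<Phi> z"
    by (rule tendsto_upperbound) simp
qed

text \<open>The event \<open>quantile c z \<le> s\<close> says that \<open>\<Phi> z\<close>, which
  is uniform under \<open>\<gamma>\<close>, is at most \<open>cdf M s\<close>.\<close>

lemma distr_quantile: "distr \<gamma> borel (quantile c) = M"
proof (rule cdf_unique)
  show "real_distribution (distr \<gamma> borel (quantile c))"
    by (rule \<gamma>.real_distribution_distr) simp
  show "cdf (distr \<gamma> borel (quantile c)) = cdf M"
  proof
    fix s
    have "cdf (distr \<gamma> borel (quantile c)) s = measure \<gamma> {z. quantile c z \<le> s}"
      by (simp add: cdf_def2 measure_distr vimage_def)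
    also have "\<dots> = cdf M s"
      using prob_Phi_le[of "cdf M s"] M.cdf_nonneg M.cdf_bounded_prob
      by (simp add: quantile_le_iff measure_def)
    finally show "cdf (distr \<gamma> borel (quantile c)) s = cdf M s" .
  qed
qed (rule real_distribution_M)

text \<open>The law \<open>M\<close> of \<open>quantile c\<close> does not charge the zeros of
  \<open>c\<close>. Hence the default values of \<open>ln\<close> and of division at 0 matter only
  on a null set.\<close>

lemma AE_c_quantile_pos: "AE z in \<gamma>. 0 < c (quantile c z)"
proof -
  have "AE x in M. 0 < c x"
    by (subst AE_density) (auto intro!: AE_I2)
  then show ?thesis
    by (subst (asm) distr_quantile[symmetric], subst (asm) AE_distr_iff) auto
qed

text \<open>Transporting the integral to \<open>M\<close> and inserting the density of
  \<open>M\<close> turns it into the integral of \<open>c x * ln (c x)\<close> under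
  \<open>\<gamma>\<close>.\<close>

lemma
  assumes "rel_ent \<gamma> c < \<infinity>"
  shows integrable_ln_quantile: "integrable \<gamma> (\<lambda>z. ln (c (quantile c z)))"
    and integral_ln_quantile: "(\<integral>z. ln (c (quantile c z)) \<partial>\<gamma>) = enn2real (rel_ent \<gamma> c)"
proof -
  note * = \<gamma>.integrable_mult_ln[OF _ nonneg total assms] \<gamma>.integral_mult_ln[OF _ nonneg total assms]
  have "integrable M (\<lambda>x. ln (c x))"
    using * by (subst integrable_density) (auto simp: nonneg)
  then show "integrable \<gamma> (\<lambda>z. ln (c (quantile c z)))"
    by (subst (asm) distr_quantile[symmetric], subst (asm) integrable_distr_eq) auto
  have "(\<integral>z. ln (c (quantile c z)) \<partial>\<gamma>) = (\<integral>x. ln (c x) \<partial>M)"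
    by (subst distr_quantile[symmetric], subst integral_distr) auto
  then show "(\<integral>z. ln (c (quantile c z)) \<partial>\<gamma>) = enn2real (rel_ent \<gamma> c)"
    using * by (simp add: integral_density nonneg)
qed

text \<open>The divisor is the Lebesgue density of \<open>M\<close> and cancels where it is
  positive. Where it is 0, the contribution of \<open>h\<close> is lost on the left-hand side, hence
  the inequality.\<close>

lemma nn_integral_M_bound:
  fixes h :: "real \<Rightarrow> ennreal"
  assumes [measurable]: "h \<in> borel_measurable borel"
  shows "(\<integral>\<^sup>+x. h x / ennreal (std_normal_density x * c x) \<partial>M) \<le> (\<integral>\<^sup>+x. h x \<partial>lborel)"
proof -
  have "(\<integral>\<^sup>+x. h x / ennreal (std_normal_density x * c x) \<partial>M) =
    (\<integral>\<^sup>+x. ennreal (std_normal_density x * c x) * (h x / ennreal (std_normal_density x * c x)) \<partial>lborel)"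
    by (subst M_eq, subst nn_integral_density) auto
  also have "\<dots> \<le> (\<integral>\<^sup>+x. h x \<partial>lborel)"
  proof (intro nn_integral_mono)
    fix x show "ennreal (std_normal_density x * c x) * (h x / ennreal (std_normal_density x * c x)) \<le> h x"
      by (cases "ennreal (std_normal_density x * c x) = 0")
        (auto simp: ennreal_times_divide mult.commute ennreal_mult_divide_eq)
  qed
  finally show ?thesis .
qed

end

text \<open>
  The coupling of \<open>\<gamma>\<close> with itself in the representation \<open>Cov (F Z) (G Z) = E (F'(X) * G'(Y))\<close>; it is
  the average over \<open>0 \<le> t \<le> 1\<close> of the Gaussian pairs with correlation \<open>t\<close>.
\<close>

definition bridge_density :: "real \<Rightarrow> real \<Rightarrow> real" where
  "bridge_density x y = bridge_kernel (\<Phi> x) (\<Phi> y) / (std_normal_density x * std_normal_density y)"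

definition bridge_coupling :: "(real \<times> real) measure" where
  "bridge_coupling = density (\<gamma> \<Otimes>\<^sub>M \<gamma>) (\<lambda>(x, y). ennreal (bridge_density x y))"

lemma bridge_density_measurable [measurable (raw)]:
  assumes [measurable]: "f \<in> borel_measurable M" "g \<in> borel_measurable M"
  shows "(\<lambda>x. bridge_density (f x) (g x)) \<in> borel_measurable M"
  unfolding bridge_density_def by measurable

lemma bridge_density_commute: "bridge_density x y = bridge_density y x"
  by (simp add: bridge_density_def bridge_kernel_commute mult.commute)

lemma bridge_density_nonneg: "0 \<le> bridge_density x y"
  unfolding bridge_density_def
  by (intro divide_nonneg_nonneg bridge_kernel_nonneg mult_nonneg_nonneg)
    (auto simp: \<gamma>.cdf_nonneg \<gamma>.cdf_bounded_prob)

text \<open>Integration against \<open>\<gamma>\<close> absorbs one of the Gaussian densities in the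
  denominator, and \<open>bridge_kernel_Phi_integral\<close> cancels the other. As the density is
  symmetric, both marginals of \<open>bridge_coupling\<close> are \<open>\<gamma>\<close>.\<close>

lemma nn_integral_bridge_density: "(\<integral>\<^sup>+y. ennreal (bridge_density x y) \<partial>\<gamma>) = 1"
proof -
  have p: "0 < std_normal_density z" for z by (simp add: normal_density_pos)
  have k: "0 \<le> bridge_kernel (\<Phi> x) (\<Phi> y)" for y
    by (intro bridge_kernel_nonneg) (auto simp: \<gamma>.cdf_nonneg \<gamma>.cdf_bounded_prob)
  have "(\<integral>\<^sup>+y. ennreal (bridge_density x y) \<partial>\<gamma>) =
    (\<integral>\<^sup>+y. ennreal (1 / std_normal_density x) * ennreal (bridge_kernel (\<Phi> x) (\<Phi> y)) \<partial>lborel)"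
  proof (subst nn_integral_density, measurable, intro nn_integral_cong)
    fix y
    have "std_normal_density y * bridge_density x y = 1 / std_normal_density x * bridge_kernel (\<Phi> x) (\<Phi> y)"
      using p[of x] p[of y] by (simp add: bridge_density_def)
    then show "ennreal (std_normal_density y) * ennreal (bridge_density x y) =
       ennreal (1 / std_normal_density x) * ennreal (bridge_kernel (\<Phi> x) (\<Phi> y))"
      using p[of x] p[of y] k by (simp add: ennreal_mult'[symmetric] less_imp_le)
  qed
  also have "\<dots> = 1"
    using p[of x]
    by (subst nn_integral_cmult, measurable, unfold bridge_kernel_Phi_integral)
      (simp add: ennreal_mult'[symmetric])
  finally show ?thesis .
qed

lemma sets_bridge_coupling [measurable_cong]: "sets bridge_coupling = sets (borel \<Otimes>\<^sub>M borel)"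
  unfolding bridge_coupling_def sets_density by (intro sets_pair_measure_cong) auto

lemma nn_integral_bridge_coupling:
  assumes [measurable]: "h \<in> borel_measurable (borel \<Otimes>\<^sub>M borel)"
  shows "(\<integral>\<^sup>+p. h p \<partial>bridge_coupling) = (\<integral>\<^sup>+x. \<integral>\<^sup>+y. ennreal (bridge_density x y) * h (x, y) \<partial>\<gamma> \<partial>\<gamma>)"
  unfolding bridge_coupling_def
  by (subst nn_integral_density) (auto simp: \<gamma>.nn_integral_fst[symmetric])

lemma distr_bridge_coupling_fst: "distr bridge_coupling borel fst = \<gamma>"
proof (rule measure_eqI)
  fix A assume A: "A \<in> sets (distr bridge_coupling borel fst)"
  then have [measurable]: "A \<in> sets borel" by simp
  have "emeasure (distr bridge_coupling borel fst) A = (\<integral>\<^sup>+p. indicator A (fst p) \<partial>bridge_coupling)"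
    by (subst nn_integral_indicator[symmetric], use A in simp, subst nn_integral_distr) auto
  also have "\<dots> = (\<integral>\<^sup>+x. \<integral>\<^sup>+y. ennreal (bridge_density x y) * indicator A x \<partial>\<gamma> \<partial>\<gamma>)"
    by (subst nn_integral_bridge_coupling) auto
  also have "\<dots> = emeasure \<gamma> A"
    by (simp add: nn_integral_multc nn_integral_bridge_density)
  finally show "emeasure (distr bridge_coupling borel fst) A = emeasure \<gamma> A" .
qed simp

lemma distr_bridge_coupling_snd: "distr bridge_coupling borel snd = \<gamma>"
proof (rule measure_eqI)
  fix A assume A: "A \<in> sets (distr bridge_coupling borel snd)"
  then have [measurable]: "A \<in> sets borel" by simp
  have "emeasure (distr bridge_coupling borel snd) A = (\<integral>\<^sup>+p. indicator A (snd p) \<partial>bridge_coupling)"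
    by (subst nn_integral_indicator[symmetric], use A in simp, subst nn_integral_distr) auto
  also have "\<dots> = (\<integral>\<^sup>+x. \<integral>\<^sup>+y. ennreal (bridge_density x y) * indicator A y \<partial>\<gamma> \<partial>\<gamma>)"
    by (subst nn_integral_bridge_coupling) auto
  also have "\<dots> = (\<integral>\<^sup>+y. \<integral>\<^sup>+x. ennreal (bridge_density x y) * indicator A y \<partial>\<gamma> \<partial>\<gamma>)"
    by (rule \<gamma>\<gamma>.Fubini'[symmetric]) measurable
  also have "\<dots> = (\<integral>\<^sup>+y. \<integral>\<^sup>+x. ennreal (bridge_density y x) * indicator A y \<partial>\<gamma> \<partial>\<gamma>)"
    by (simp only: bridge_density_commute)
  also have "\<dots> = emeasure \<gamma> A"
    by (simp add: nn_integral_multc nn_integral_bridge_density)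
  finally show "emeasure (distr bridge_coupling borel snd) A = emeasure \<gamma> A" .
qed simp

text \<open>The bound \<open>exp r \<ge> 1 + r\<close> is integrated over the coupling. Its
  right-hand side is a sum of functions of one variable each, so only the marginals enter.\<close>

lemma bridge_coupling_exp_bound:
  fixes l m :: "real \<Rightarrow> real"
  assumes l: "integrable \<gamma> l" and m: "integrable \<gamma> m"
    and C: "(\<integral>\<^sup>+p. ennreal (exp (l (fst p) + m (snd p))) \<partial>bridge_coupling) \<le> ennreal C"
  shows "1 + (\<integral>x. l x \<partial>\<gamma>) + (\<integral>x. m x \<partial>\<gamma>) \<le> C"
proof -
  have [measurable]: "l \<in> borel_measurable borel" "m \<in> borel_measurable borel"
    using l m by (auto dest: borel_measurable_integrable)
  have [measurable]: "fst \<in> borel_measurable bridge_coupling" "snd \<in> borel_measurable bridge_coupling"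
    by measurable
  interpret W: prob_space bridge_coupling
  proof (rule prob_spaceI)
    have "emeasure (distr bridge_coupling borel fst) UNIV = 1"
      unfolding distr_bridge_coupling_fst using \<gamma>.emeasure_space_1 by simp
    then show "emeasure bridge_coupling (space bridge_coupling) = 1"
      by (subst (asm) emeasure_distr) auto
  qed
  have L: "integrable bridge_coupling (\<lambda>p. l (fst p))" "(\<integral>p. l (fst p) \<partial>bridge_coupling) = (\<integral>x. l x \<partial>\<gamma>)"
    using l by (simp_all add: distr_bridge_coupling_fst[symmetric] integrable_distr_eq integral_distr)
  have R: "integrable bridge_coupling (\<lambda>p. m (snd p))" "(\<integral>p. m (snd p) \<partial>bridge_coupling) = (\<integral>x. m x \<partial>\<gamma>)"
    using m by (simp_all add: distr_bridge_coupling_snd[symmetric] integrable_distr_eq integral_distr)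
  let ?e = "\<lambda>p. exp (l (fst p) + m (snd p))"
  have e: "integrable bridge_coupling ?e"
    using C by (intro integrableI_nonneg) (auto intro: le_less_trans)
  have "1 + (\<integral>x. l x \<partial>\<gamma>) + (\<integral>x. m x \<partial>\<gamma>) = (\<integral>p. 1 + l (fst p) + m (snd p) \<partial>bridge_coupling)"
    using L R by (simp add: W.prob_space)
  also have "\<dots> \<le> (\<integral>p. ?e p \<partial>bridge_coupling)"
    using L R e by (intro integral_mono) (auto simp: add.assoc exp_ge_add_one_self)
  also have "\<dots> = enn2real (\<integral>\<^sup>+p. ennreal (?e p) \<partial>bridge_coupling)"
    by (intro integral_eq_nn_integral) auto
  also have "\<dots> \<le> C"
  proof (rule enn2real_leI[OF _ C])
    \<comment> \<open>A positive function has a nonzero integral over a probability space, so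
      \<open>C\<close> cannot be a negative number that \<open>ennreal\<close> truncates to
      0.\<close>
    have "(\<integral>\<^sup>+p. ennreal (?e p) \<partial>bridge_coupling) \<noteq> 0"
    proof
      assume "(\<integral>\<^sup>+p. ennreal (?e p) \<partial>bridge_coupling) = 0"
      then have "AE p in bridge_coupling. ennreal (?e p) = 0"
        by (subst (asm) nn_integral_0_iff_AE) auto
      then have "AE p in bridge_coupling. False"
        by eventually_elim (simp add: ennreal_eq_0_iff not_le)
      then show False using W.AE_False by simp
    qed
    then show "0 \<le> C" using C by (cases "0 \<le> C") (auto simp: ennreal_neg)
  qed
  finally show ?thesis .
qed

lemma integrable_square_imp_integrable_mult:
  fixes F G :: "'a \<Rightarrow> real"
  assumes [measurable]: "F \<in> borel_measurable M" "G \<in> borel_measurable M"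
    and "integrable M (\<lambda>z. (F z)\<^sup>2)" "integrable M (\<lambda>z. (G z)\<^sup>2)"
  shows "integrable M (\<lambda>z. F z * G z)"
proof (rule Bochner_Integration.integrable_bound)
  show "integrable M (\<lambda>z. (F z)\<^sup>2 + (G z)\<^sup>2)" using assms by simp
  have "\<bar>a * b\<bar> \<le> a\<^sup>2 + b\<^sup>2" for a b :: real
  proof -
    have "0 \<le> \<bar>a\<bar> * \<bar>b\<bar>" "2 * (\<bar>a\<bar> * \<bar>b\<bar>) \<le> a\<^sup>2 + b\<^sup>2"
      using sum_squares_bound[of "\<bar>a\<bar>" "\<bar>b\<bar>"] by simp_all
    then show ?thesis unfolding abs_mult by linarith
  qed
  then show "AE z in M. norm (F z * G z) \<le> norm ((F z)\<^sup>2 + (G z)\<^sup>2)" by simp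
qed measurable

text \<open>Formal differentiation of \<open>cdf M (F x) = \<Phi> x\<close> gives the right-hand
  side as the derivative of \<open>F\<close> at \<open>x\<close>, with \<open>y = F x\<close> and
  \<open>a = c (F x)\<close>. Only this expression is used later; nothing is claimed about the
  differentiability of \<open>F\<close>.\<close>

lemma std_normal_density_ratio:
  assumes "0 < a"
  shows "exp (y\<^sup>2 / 2 - x\<^sup>2 / 2 - ln a) = std_normal_density x / (std_normal_density y * a)"
proof -
  have e: "exp (- z\<^sup>2 / 2) = 1 / exp (z\<^sup>2 / 2)" for z :: real
    using exp_minus[of "z\<^sup>2 / 2"] by (simp add: inverse_eq_divide)
  have "exp (y\<^sup>2 / 2 - x\<^sup>2 / 2 - ln a) = exp (y\<^sup>2 / 2) / exp (x\<^sup>2 / 2) / a"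
    using assms by (simp only: exp_diff exp_ln)
  then show ?thesis
    unfolding std_normal_density_def e by simp
qed

text \<open>The lower bound for the covariance consists of half the second moments minus the
  entropies, the constants \<open>1 - 1/2 - 1/2\<close> cancelling. When the square is expanded, the
  second moments cancel too, and the product of the means is left over from the covariance.\<close>

theorem symmetrized_Talagrand_line:
  assumes c: "gauss_density c" and d: "gauss_density d"
    and F2: "integrable \<gamma> (\<lambda>z. (quantile c z)\<^sup>2)" and G2: "integrable \<gamma> (\<lambda>z. (quantile d z)\<^sup>2)"
    and ec: "rel_ent \<gamma> c < \<infinity>" and ed: "rel_ent \<gamma> d < \<infinity>"
  shows "(\<integral>z. (quantile c z - quantile d z)\<^sup>2 \<partial>\<gamma>) \<le>
    2 * enn2real (rel_ent \<gamma> c) + 2 * enn2real (rel_ent \<gamma> d)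
      - 2 * (\<integral>z. quantile c z \<partial>\<gamma>) * (\<integral>z. quantile d z \<partial>\<gamma>)"
proof -
  interpret c: gauss_density c by fact
  interpret d: gauss_density d by fact
  define F where "F = quantile c"
  define G where "G = quantile d"
  define A where "A = cdf c.M"
  define B where "B = cdf d.M"
  have [measurable]: "F \<in> borel_measurable borel" "G \<in> borel_measurable borel"
    "A \<in> borel_measurable borel" "B \<in> borel_measurable borel"
    by (simp_all add: F_def G_def A_def B_def)
  have int: "integrable \<gamma> F" "integrable \<gamma> G" "integrable \<gamma> (\<lambda>z. F z * G z)"
    "integrable \<gamma> (\<lambda>z. (F z)\<^sup>2)" "integrable \<gamma> (\<lambda>z. (G z)\<^sup>2)"
    using F2 G2 integrable_square_imp_integrable_mult[of F \<gamma> G]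
    by (auto simp: F_def[symmetric] G_def[symmetric] intro: \<gamma>.square_integrable_imp_integrable)
  define C where "C = (\<integral>z. F z * G z \<partial>\<gamma>) - (\<integral>z. F z \<partial>\<gamma>) * (\<integral>z. G z \<partial>\<gamma>)"
  define k where "k s t = ennreal (bridge_kernel (A s) (B t))" for s t
  have [measurable]: "(\<lambda>x. k (f x) (g x)) \<in> borel_measurable N"
    if [measurable]: "f \<in> borel_measurable N" "g \<in> borel_measurable N" for f g and N :: "'x measure"
    unfolding k_def by measurable
  have kC: "(\<integral>\<^sup>+s. \<integral>\<^sup>+t. k s t \<partial>lborel \<partial>lborel) = ennreal C"
    unfolding k_def C_def
  proof (rule Hoeffding_covariance)
    show "F z \<le> s \<longleftrightarrow> \<Phi> z \<le> A s" "G z \<le> s \<longleftrightarrow> \<Phi> z \<le> B s" for z s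
      unfolding F_def G_def A_def B_def by (rule c.quantile_le_iff d.quantile_le_iff)+
  qed (use int in \<open>simp_all add: A_def B_def c.M.cdf_nonneg d.M.cdf_nonneg c.M.cdf_bounded_prob d.M.cdf_bounded_prob\<close>)
  text \<open>\<open>l\<close> and \<open>m\<close> are the logarithms of the derivatives of \<open>F\<close> and \<open>G\<close>.\<close>
  define l where "l z = (F z)\<^sup>2 / 2 - z\<^sup>2 / 2 - ln (c (F z))" for z
  define m where "m z = (G z)\<^sup>2 / 2 - z\<^sup>2 / 2 - ln (d (G z))" for z
  have l: "integrable \<gamma> l" "(\<integral>z. l z \<partial>\<gamma>) = (\<integral>z. (F z)\<^sup>2 \<partial>\<gamma>) / 2 - 1 / 2 - enn2real (rel_ent \<gamma> c)"
    unfolding l_def using int std_normal_integrable c.integrable_ln_quantile[OF ec, folded F_def]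
    by (simp_all add: std_normal_second_moment c.integral_ln_quantile[OF ec, folded F_def])
  have m: "integrable \<gamma> m" "(\<integral>z. m z \<partial>\<gamma>) = (\<integral>z. (G z)\<^sup>2 \<partial>\<gamma>) / 2 - 1 / 2 - enn2real (rel_ent \<gamma> d)"
    unfolding m_def using int std_normal_integrable d.integrable_ln_quantile[OF ed, folded G_def]
    by (simp_all add: std_normal_second_moment d.integral_ln_quantile[OF ed, folded G_def])
  have [measurable]: "l \<in> borel_measurable borel" "m \<in> borel_measurable borel"
    unfolding l_def m_def by measurable
  \<comment> \<open>In the variables \<open>s = F x\<close> and \<open>t = G y\<close>, this is the
    density of the coupling times the formal derivatives of \<open>F\<close> and \<open>G\<close>:
    the Gaussian densities at \<open>x\<close> and \<open>y\<close> cancel, and the Lebesgue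
    densities of the image laws remain as divisors.\<close>
  define h where "h s t = k s t / ennreal (std_normal_density t * d t) / ennreal (std_normal_density s * c s)" for s t
  have hm[measurable]: "(\<lambda>x. h (f x) (g x)) \<in> borel_measurable N"
    if [measurable]: "f \<in> borel_measurable N" "g \<in> borel_measurable N" for f g and N :: "'x measure"
    unfolding h_def by measurable
  have pw: "ennreal (bridge_density x y) * ennreal (exp (l x + m y)) = h (F x) (G y)"
    if "0 < c (F x)" "0 < d (G y)" for x y
  proof -
    have p: "0 < std_normal_density z" for z by (simp add: normal_density_pos)
    have AB: "A (F x) = \<Phi> x" "B (G y) = \<Phi> y"
      by (simp_all add: A_def B_def F_def G_def c.cdf_quantile d.cdf_quantile)
    have "bridge_density x y * exp (l x + m y) =
      bridge_density x y * (std_normal_density x / (std_normal_density (F x) * c (F x)))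
        * (std_normal_density y / (std_normal_density (G y) * d (G y)))"
      using that by (simp add: l_def m_def exp_add std_normal_density_ratio)
    also have "\<dots> = bridge_kernel (A (F x)) (B (G y)) / (std_normal_density (G y) * d (G y)) / (std_normal_density (F x) * c (F x))"
      using p[of x] p[of y] by (simp add: bridge_density_def AB)
    finally have eq: "bridge_density x y * exp (l x + m y) = \<dots>" .
    have k0: "0 \<le> bridge_kernel (A (F x)) (B (G y))"
      unfolding AB by (intro bridge_kernel_nonneg) (auto simp: \<gamma>.cdf_nonneg \<gamma>.cdf_bounded_prob)
    have pc: "0 < std_normal_density (F x) * c (F x)" and pd: "0 < std_normal_density (G y) * d (G y)"
      using that p by simp_all
    have "ennreal (bridge_density x y) * ennreal (exp (l x + m y)) = ennreal (bridge_density x y * exp (l x + m y))"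
      by (simp add: ennreal_mult bridge_density_nonneg)
    also have "\<dots> = h (F x) (G y)"
      unfolding eq h_def k_def
      using k0 pc pd by (simp only: divide_ennreal divide_nonneg_pos)
    finally show ?thesis .
  qed
  have "(\<integral>\<^sup>+p. ennreal (exp (l (fst p) + m (snd p))) \<partial>bridge_coupling)
      = (\<integral>\<^sup>+x. \<integral>\<^sup>+y. ennreal (bridge_density x y) * ennreal (exp (l x + m y)) \<partial>\<gamma> \<partial>\<gamma>)"
    by (subst nn_integral_bridge_coupling) auto
  also have "\<dots> = (\<integral>\<^sup>+x. \<integral>\<^sup>+y. h (F x) (G y) \<partial>\<gamma> \<partial>\<gamma>)"
  proof (rule nn_integral_cong_AE)
    show "AE x in \<gamma>. (\<integral>\<^sup>+y. ennreal (bridge_density x y) * ennreal (exp (l x + m y)) \<partial>\<gamma>) = (\<integral>\<^sup>+y. h (F x) (G y) \<partial>\<gamma>)"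
      using c.AE_c_quantile_pos
    proof eventually_elim
      case (elim x)
      show ?case
        using d.AE_c_quantile_pos elim
        by (intro nn_integral_cong_AE) (auto simp: pw F_def[symmetric] G_def[symmetric] elim!: eventually_mono)
    qed
  qed
  also have "\<dots> = (\<integral>\<^sup>+x. \<integral>\<^sup>+t. h (F x) t \<partial>d.M \<partial>\<gamma>)"
  proof (intro nn_integral_cong)
    fix x show "(\<integral>\<^sup>+y. h (F x) (G y) \<partial>\<gamma>) = (\<integral>\<^sup>+t. h (F x) t \<partial>d.M)"
      unfolding d.distr_quantile[symmetric] G_def[symmetric]
      by (rule nn_integral_distr[symmetric]) measurable
  qed
  also have "\<dots> = (\<integral>\<^sup>+s. \<integral>\<^sup>+t. h s t \<partial>d.M \<partial>c.M)"
    unfolding c.distr_quantile[symmetric] F_def[symmetric]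
    by (rule nn_integral_distr[symmetric]) measurable
  \<comment> \<open>The change of variables back to Lebesgue measure, first in \<open>t\<close> and
    then in \<open>s\<close>. It is an inequality, since \<open>k\<close> may be positive where
    \<open>c\<close> or \<open>d\<close> vanishes.\<close>
  also have "\<dots> \<le> (\<integral>\<^sup>+s. (\<integral>\<^sup>+t. k s t \<partial>lborel) / ennreal (std_normal_density s * c s) \<partial>c.M)"
  proof (intro nn_integral_mono)
    fix s
    have "(\<integral>\<^sup>+t. h s t \<partial>d.M) = (\<integral>\<^sup>+t. k s t / ennreal (std_normal_density t * d t) \<partial>d.M) / ennreal (std_normal_density s * c s)"
      unfolding h_def by (rule nn_integral_divide) measurable
    also have "\<dots> \<le> (\<integral>\<^sup>+t. k s t \<partial>lborel) / ennreal (std_normal_density s * c s)"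
      by (intro divide_right_mono_ennreal d.nn_integral_M_bound) measurable
    finally show "(\<integral>\<^sup>+t. h s t \<partial>d.M) \<le> (\<integral>\<^sup>+t. k s t \<partial>lborel) / ennreal (std_normal_density s * c s)" .
  qed
  also have "\<dots> \<le> (\<integral>\<^sup>+s. \<integral>\<^sup>+t. k s t \<partial>lborel \<partial>lborel)"
    by (intro c.nn_integral_M_bound) measurable
  also note kC
  finally have *: "(\<integral>\<^sup>+p. ennreal (exp (l (fst p) + m (snd p))) \<partial>bridge_coupling) \<le> ennreal C" .
  have "1 + (\<integral>z. l z \<partial>\<gamma>) + (\<integral>z. m z \<partial>\<gamma>) \<le> C"
    by (rule bridge_coupling_exp_bound[OF l(1) m(1) *])
  moreover have "(\<integral>z. (F z - G z)\<^sup>2 \<partial>\<gamma>) = (\<integral>z. (F z)\<^sup>2 \<partial>\<gamma>) + (\<integral>z. (G z)\<^sup>2 \<partial>\<gamma>) - 2 * (\<integral>z. F z * G z \<partial>\<gamma>)"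
    using int by (simp add: power2_diff mult.assoc)
  ultimately show ?thesis
    unfolding l m C_def F_def[symmetric] G_def[symmetric] mult.assoc by linarith
qed

subsection \<open>Knothe maps\<close>

text \<open>The chain rule on a single fibre of mass \<open>a\<close> with conditional density
  \<open>c\<close>. It comes from \<open>ln (a * t) = ln a + ln t\<close> for positive
  \<open>t\<close>, integrated with \<open>c\<close> of total mass 1. For \<open>a = 0\<close> both
  sides are 1, and an infinite right-hand side leaves nothing to prove.\<close>

lemma (in prob_space) entropy_scaled_density:
  assumes [measurable]: "c \<in> borel_measurable M" and nonneg: "\<And>y. 0 \<le> c y"
    and total: "(\<integral>\<^sup>+y. ennreal (c y) \<partial>M) = 1" and "0 \<le> a"
  shows "ennreal (entropy_fun a) + ennreal a * rel_ent M c \<le> rel_ent M (\<lambda>y. a * c y)"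
proof (cases "a = 0 \<or> rel_ent M (\<lambda>y. a * c y) = \<infinity>")
  case True
  then show ?thesis by (auto simp: rel_ent_def entropy_fun_def emeasure_space_1)
next
  case False
  then have a: "0 < a" and fin: "rel_ent M (\<lambda>y. a * c y) < \<infinity>"
    using \<open>0 \<le> a\<close> by (auto simp: less_top)
  have c: "integrable M c" using total nonneg by (intro integrableI_nonneg) auto
  have c1: "(\<integral>x. c x \<partial>M) = 1" using total nonneg by (subst integral_eq_nn_integral) auto
  have e: "integrable M (\<lambda>y. entropy_fun (a * c y))"
    using fin nonneg a unfolding rel_ent_def by (intro integrableI_nonneg) (auto simp: entropy_fun_nonneg)
  have eq: "a * entropy_fun (c y) = entropy_fun (a * c y) - c y * (a * ln a) + (a - 1)" for y
    using a nonneg[of y] by (cases "c y = 0") (auto simp: entropy_fun_def ln_mult algebra_simps)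
  have i: "integrable M (\<lambda>y. a * entropy_fun (c y))"
    unfolding eq using e c by simp
  have I: "(\<integral>y. a * entropy_fun (c y) \<partial>M) = (\<integral>y. entropy_fun (a * c y) \<partial>M) - entropy_fun a"
    unfolding eq using e c by (simp add: c1 prob_space) (simp add: entropy_fun_def)
  have "ennreal a * rel_ent M c = (\<integral>\<^sup>+y. ennreal (a * entropy_fun (c y)) \<partial>M)"
    using a nonneg unfolding rel_ent_def
    by (subst nn_integral_cmult[symmetric]) (auto simp: ennreal_mult entropy_fun_nonneg)
  also have "\<dots> = ennreal (\<integral>y. a * entropy_fun (c y) \<partial>M)"
    using a nonneg by (intro nn_integral_eq_integral i) (auto simp: entropy_fun_nonneg)
  finally have L: "ennreal a * rel_ent M c = ennreal (\<integral>y. a * entropy_fun (c y) \<partial>M)" .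
  have "rel_ent M (\<lambda>y. a * c y) = ennreal (\<integral>y. entropy_fun (a * c y) \<partial>M)"
    unfolding rel_ent_def using a nonneg by (intro nn_integral_eq_integral e) (auto simp: entropy_fun_nonneg)
  moreover have "0 \<le> (\<integral>y. a * entropy_fun (c y) \<partial>M)"
    using a nonneg by (intro Bochner_Integration.integral_nonneg) (auto simp: entropy_fun_nonneg)
  ultimately show ?thesis
    using L I a by (simp add: ennreal_plus[symmetric] entropy_fun_nonneg del: ennreal_plus)
qed

text \<open>By \<open>quantile_le_iff\<close>, a sublevel set compares \<open>\<Phi> z\<close> with
  the distribution function at \<open>s\<close>, which is an integral of \<open>c x\<close> and
  therefore measurable in the parameter \<open>x\<close>.\<close>

lemma measurable_quantile_param:
  assumes c[measurable]: "(\<lambda>(x, y). c x y) \<in> borel_measurable (M \<Otimes>\<^sub>M borel)"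
    and dens: "\<And>x. x \<in> space M \<Longrightarrow> gauss_density (c x)"
  shows "(\<lambda>(x, z). quantile (c x) z) \<in> borel_measurable (M \<Otimes>\<^sub>M borel)"
proof (subst borel_measurable_iff_le, intro allI)
  fix s
  have "{p \<in> space (M \<Otimes>\<^sub>M borel). (case p of (x, z) \<Rightarrow> quantile (c x) z) \<le> s}
    = {p \<in> space (M \<Otimes>\<^sub>M borel). ennreal (\<Phi> (snd p)) \<le> (\<integral>\<^sup>+y. ennreal (c (fst p) y) * indicator {..s} y \<partial>\<gamma>)}"
  proof (intro Collect_cong conj_cong refl)
    fix p :: "'a \<times> real" assume "p \<in> space (M \<Otimes>\<^sub>M borel)"
    then interpret gauss_density "c (fst p)"
      by (intro dens) (auto simp: space_pair_measure)
    show "((case p of (x, z) \<Rightarrow> quantile (c x) z) \<le> s) =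
      (ennreal (\<Phi> (snd p)) \<le> (\<integral>\<^sup>+y. ennreal (c (fst p) y) * indicator {..s} y \<partial>\<gamma>))"
      by (simp add: case_prod_beta quantile_le_iff emeasure_density[symmetric] cdf_def2 M.emeasure_eq_measure)
  qed
  also have "\<dots> \<in> sets (M \<Otimes>\<^sub>M borel)" by measurable
  finally show "{p \<in> space (M \<Otimes>\<^sub>M borel). (case p of (x, z) \<Rightarrow> quantile (c x) z) \<le> s} \<in> sets (M \<Otimes>\<^sub>M borel)" .
qed

lemma gauss_density_const_1: "gauss_density (\<lambda>_. 1)"
  by standard (simp_all add: \<gamma>.emeasure_space_1[simplified])

section \<open>Disintegration of a density along one real coordinate\<close>

definition marginal :: "('a \<times> real \<Rightarrow> real) \<Rightarrow> 'a \<Rightarrow> real" where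
  "marginal f x = enn2real (\<integral>\<^sup>+y. ennreal (f (x, y)) \<partial>\<gamma>)"

text \<open>
  Since \<open>enn2real \<infinity> = 0\<close>, the value \<open>1\<close> is taken where the marginal density is \<open>0\<close> or infinite, so that
  every section is a probability density.
\<close>

definition conditional :: "('a \<times> real \<Rightarrow> real) \<Rightarrow> 'a \<Rightarrow> real \<Rightarrow> real" where
  "conditional f x y = (if 0 < marginal f x then f (x, y) / marginal f x else 1)"

locale fibred_density = prob_space M for M :: "'a measure" +
  fixes f :: "'a \<times> real \<Rightarrow> real"
  assumes measurable_f [measurable]: "f \<in> borel_measurable (M \<Otimes>\<^sub>M borel)"
    and nonneg: "0 \<le> f p"
    and total: "(\<integral>\<^sup>+p. ennreal (f p) \<partial>(M \<Otimes>\<^sub>M \<gamma>)) = 1"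
begin

lemma sets_pair_normal [measurable_cong]: "sets (M \<Otimes>\<^sub>M \<gamma>) = sets (M \<Otimes>\<^sub>M borel)"
  by (intro sets_pair_measure_cong) auto

lemma measurable_marginal [measurable]: "marginal f \<in> borel_measurable M"
  unfolding marginal_def by measurable

lemma marginal_nonneg: "0 \<le> marginal f x"
  by (simp add: marginal_def)

lemma measurable_conditional [measurable]: "(\<lambda>(x, y). conditional f x y) \<in> borel_measurable (M \<Otimes>\<^sub>M borel)"
  unfolding conditional_def by measurable

lemma AE_marginal: "AE x in M. ennreal (marginal f x) = (\<integral>\<^sup>+y. ennreal (f (x, y)) \<partial>\<gamma>)"
proof -
  have "(\<integral>\<^sup>+x. \<integral>\<^sup>+y. ennreal (f (x, y)) \<partial>\<gamma> \<partial>M) = 1"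
    using total by (subst \<gamma>.nn_integral_fst) auto
  then have "AE x in M. (\<integral>\<^sup>+y. ennreal (f (x, y)) \<partial>\<gamma>) \<noteq> \<infinity>"
    by (intro nn_integral_PInf_AE) auto
  then show ?thesis
    by eventually_elim (simp add: marginal_def less_top)
qed

lemma total_marginal: "(\<integral>\<^sup>+x. ennreal (marginal f x) \<partial>M) = 1"
proof -
  have "(\<integral>\<^sup>+x. ennreal (marginal f x) \<partial>M) = (\<integral>\<^sup>+x. \<integral>\<^sup>+y. ennreal (f (x, y)) \<partial>\<gamma> \<partial>M)"
    by (intro nn_integral_cong_AE AE_marginal)
  then show ?thesis using total by (subst (asm) \<gamma>.nn_integral_fst) auto
qed

lemma gauss_density_conditional:
  assumes x: "x \<in> space M"
  shows "gauss_density (conditional f x)"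
proof (cases "0 < marginal f x")
  case True
  show ?thesis
  proof
    show "conditional f x \<in> borel_measurable borel"
      unfolding conditional_def[abs_def] using x by measurable
    show "0 \<le> conditional f x y" for y
      using True nonneg by (simp add: conditional_def)
    have "(\<integral>\<^sup>+y. ennreal (conditional f x y) \<partial>\<gamma>) = (\<integral>\<^sup>+y. ennreal (f (x, y)) / ennreal (marginal f x) \<partial>\<gamma>)"
      using True nonneg by (intro nn_integral_cong) (simp add: conditional_def divide_ennreal)
    also have "\<dots> = (\<integral>\<^sup>+y. ennreal (f (x, y)) \<partial>\<gamma>) / ennreal (marginal f x)"
      using x by (intro nn_integral_divide) measurable
    also have "(\<integral>\<^sup>+y. ennreal (f (x, y)) \<partial>\<gamma>) = ennreal (marginal f x)"
      using True unfolding marginal_def by (auto simp: less_top enn2real_positive_iff)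
    finally show "(\<integral>\<^sup>+y. ennreal (conditional f x y) \<partial>\<gamma>) = 1"
      using True by (simp add: divide_ennreal)
  qed
next
  case False
  then show ?thesis using gauss_density_const_1 by (simp add: conditional_def[abs_def])
qed

text \<open>The sections with infinite integral form a null set. On the others, a marginal value of
  0 means that the section has integral 0 and vanishes almost everywhere, whatever
  \<open>conditional\<close> is there.\<close>

lemma AE_disintegration: "AE x in M. AE y in \<gamma>. f (x, y) = marginal f x * conditional f x y"
  using AE_marginal AE_space
proof eventually_elim
  case (elim x)
  show ?case
  proof (cases "0 < marginal f x")
    case True
    then show ?thesis by (simp add: conditional_def)
  next
    case False
    then have "marginal f x = 0" using marginal_nonneg[of x] by simp
    with elim have "(\<integral>\<^sup>+y. ennreal (f (x, y)) \<partial>\<gamma>) = 0" by simp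
    then have "AE y in \<gamma>. ennreal (f (x, y)) = 0"
      using elim(2) by (subst (asm) nn_integral_0_iff_AE) auto
    then show ?thesis
      using \<open>marginal f x = 0\<close> nonneg by (auto elim!: eventually_mono simp: ennreal_eq_0_iff intro: antisym)
  qed
qed

text \<open>By the disintegration, \<open>entropy_scaled_density\<close> applies on almost every
  fibre with \<open>a = marginal f x\<close>; the result is integrated over
  \<open>x\<close>.\<close>

lemma rel_ent_chain:
  "rel_ent M (marginal f) + (\<integral>\<^sup>+x. ennreal (marginal f x) * rel_ent \<gamma> (conditional f x) \<partial>M)
    \<le> rel_ent (M \<Otimes>\<^sub>M \<gamma>) f"
proof -
  have [measurable]: "(\<lambda>x. rel_ent \<gamma> (conditional f x)) \<in> borel_measurable M"
    unfolding rel_ent_def by measurable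
  have "rel_ent M (marginal f) + (\<integral>\<^sup>+x. ennreal (marginal f x) * rel_ent \<gamma> (conditional f x) \<partial>M)
    = (\<integral>\<^sup>+x. ennreal (entropy_fun (marginal f x)) + ennreal (marginal f x) * rel_ent \<gamma> (conditional f x) \<partial>M)"
    unfolding rel_ent_def[of M] by (rule nn_integral_add[symmetric]) measurable
  also have "\<dots> \<le> (\<integral>\<^sup>+x. \<integral>\<^sup>+y. ennreal (entropy_fun (f (x, y))) \<partial>\<gamma> \<partial>M)"
  proof (rule nn_integral_mono_AE)
    show "AE x in M. ennreal (entropy_fun (marginal f x)) + ennreal (marginal f x) * rel_ent \<gamma> (conditional f x)
      \<le> (\<integral>\<^sup>+y. ennreal (entropy_fun (f (x, y))) \<partial>\<gamma>)"
      using AE_disintegration AE_space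
    proof eventually_elim
      case (elim x)
      interpret gauss_density "conditional f x" using elim(2) by (rule gauss_density_conditional)
      have "ennreal (entropy_fun (marginal f x)) + ennreal (marginal f x) * rel_ent \<gamma> (conditional f x)
        \<le> rel_ent \<gamma> (\<lambda>y. marginal f x * conditional f x y)"
        using nonneg total by (intro \<gamma>.entropy_scaled_density marginal_nonneg) auto
      also have "\<dots> = (\<integral>\<^sup>+y. ennreal (entropy_fun (f (x, y))) \<partial>\<gamma>)"
        unfolding rel_ent_def using elim(1) by (intro nn_integral_cong_AE) (auto elim!: eventually_mono)
      finally show ?case .
    qed
  qed
  also have "\<dots> = rel_ent (M \<Otimes>\<^sub>M \<gamma>) f"
    unfolding rel_ent_def by (subst \<gamma>.nn_integral_fst[symmetric]) auto
  finally show ?thesis .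
qed

text \<open>The induction step of the Knothe construction. Given \<open>w\<close>, the new
  coordinate has density \<open>conditional f (T w)\<close> with respect to \<open>\<gamma>\<close>;
  averaging over the law of \<open>T w\<close> brings in the factor \<open>marginal f\<close>, and
  the product is \<open>f\<close> again.\<close>

lemma distr_quantile_conditional:
  assumes T[measurable]: "T \<in> measurable N M" and dT: "distr N M T = density M (marginal f)"
  shows "distr (N \<Otimes>\<^sub>M \<gamma>) (M \<Otimes>\<^sub>M \<gamma>) (\<lambda>(w, z). (T w, quantile (conditional f (T w)) z)) = density (M \<Otimes>\<^sub>M \<gamma>) f"
    (is "distr _ _ ?S = _")
proof (rule measure_eqI)
  have Q[measurable]: "(\<lambda>(x, z). quantile (conditional f x) z) \<in> borel_measurable (M \<Otimes>\<^sub>M borel)"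
    by (intro measurable_quantile_param measurable_conditional gauss_density_conditional)
  have [measurable_cong]: "sets (N \<Otimes>\<^sub>M \<gamma>) = sets (N \<Otimes>\<^sub>M borel)"
    by (intro sets_pair_measure_cong) auto
  have S[measurable]: "?S \<in> measurable (N \<Otimes>\<^sub>M \<gamma>) (M \<Otimes>\<^sub>M \<gamma>)" by measurable
  fix A assume "A \<in> sets (distr (N \<Otimes>\<^sub>M \<gamma>) (M \<Otimes>\<^sub>M \<gamma>) ?S)"
  then have A[measurable]: "A \<in> sets (M \<Otimes>\<^sub>M borel)" by (simp add: sets_pair_normal)
  then have A': "A \<in> sets (M \<Otimes>\<^sub>M \<gamma>)" by (simp add: sets_pair_normal)
  have "emeasure (distr (N \<Otimes>\<^sub>M \<gamma>) (M \<Otimes>\<^sub>M \<gamma>) ?S) A = (\<integral>\<^sup>+p. indicator A (?S p) \<partial>(N \<Otimes>\<^sub>M \<gamma>))"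
    using A' by (subst nn_integral_indicator[symmetric], simp, subst nn_integral_distr) auto
  also have "\<dots> = (\<integral>\<^sup>+w. \<integral>\<^sup>+z. indicator A (T w, quantile (conditional f (T w)) z) \<partial>\<gamma> \<partial>N)"
    by (subst \<gamma>.nn_integral_fst[symmetric]) auto
  also have "\<dots> = (\<integral>\<^sup>+w. \<integral>\<^sup>+y. ennreal (conditional f (T w) y) * indicator A (T w, y) \<partial>\<gamma> \<partial>N)"
  proof (rule nn_integral_cong)
    fix w assume w: "w \<in> space N"
    then have Tw: "T w \<in> space M" by (rule measurable_space[OF T])
    interpret gauss_density "conditional f (T w)" using Tw by (rule gauss_density_conditional)
    have "(\<integral>\<^sup>+z. indicator A (T w, quantile (conditional f (T w)) z) \<partial>\<gamma>) = (\<integral>\<^sup>+y. indicator A (T w, y) \<partial>distr \<gamma> borel (quantile (conditional f (T w))))"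
      using Tw by (subst nn_integral_distr) auto
    also have "\<dots> = (\<integral>\<^sup>+y. ennreal (conditional f (T w) y) * indicator A (T w, y) \<partial>\<gamma>)"
      unfolding distr_quantile using Tw by (subst nn_integral_density) auto
    finally show "(\<integral>\<^sup>+z. indicator A (T w, quantile (conditional f (T w)) z) \<partial>\<gamma>)
      = (\<integral>\<^sup>+y. ennreal (conditional f (T w) y) * indicator A (T w, y) \<partial>\<gamma>)" .
  qed
  also have "\<dots> = (\<integral>\<^sup>+x. \<integral>\<^sup>+y. ennreal (conditional f x y) * indicator A (x, y) \<partial>\<gamma> \<partial>distr N M T)"
    by (subst nn_integral_distr) auto
  also have "\<dots> = (\<integral>\<^sup>+x. ennreal (marginal f x) * (\<integral>\<^sup>+y. ennreal (conditional f x y) * indicator A (x, y) \<partial>\<gamma>) \<partial>M)"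
    unfolding dT by (subst nn_integral_density) auto
  also have "\<dots> = (\<integral>\<^sup>+x. \<integral>\<^sup>+y. ennreal (f (x, y)) * indicator A (x, y) \<partial>\<gamma> \<partial>M)"
  proof (rule nn_integral_cong_AE)
    show "AE x in M. ennreal (marginal f x) * (\<integral>\<^sup>+y. ennreal (conditional f x y) * indicator A (x, y) \<partial>\<gamma>)
      = (\<integral>\<^sup>+y. ennreal (f (x, y)) * indicator A (x, y) \<partial>\<gamma>)"
      using AE_disintegration AE_space
    proof eventually_elim
      case (elim x)
      have "ennreal (marginal f x) * (\<integral>\<^sup>+y. ennreal (conditional f x y) * indicator A (x, y) \<partial>\<gamma>)
        = (\<integral>\<^sup>+y. ennreal (marginal f x) * (ennreal (conditional f x y) * indicator A (x, y)) \<partial>\<gamma>)"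
        using elim(2) by (intro nn_integral_cmult[symmetric]) measurable
      also have "\<dots> = (\<integral>\<^sup>+y. ennreal (f (x, y)) * indicator A (x, y) \<partial>\<gamma>)"
        using elim(1) by (intro nn_integral_cong_AE)
          (auto elim!: eventually_mono simp: ennreal_mult' marginal_nonneg mult.assoc)
      finally show ?case .
    qed
  qed
  also have "\<dots> = emeasure (density (M \<Otimes>\<^sub>M \<gamma>) f) A"
    using A' by (subst emeasure_density, measurable, subst \<gamma>.nn_integral_fst[symmetric]) auto
  finally show "emeasure (distr (N \<Otimes>\<^sub>M \<gamma>) (M \<Otimes>\<^sub>M \<gamma>) ?S) A = emeasure (density (M \<Otimes>\<^sub>M \<gamma>) f) A" .
qed simp

end

section \<open>Products of the Gaussian measure\<close>

abbreviation normal_PiM :: "'i set \<Rightarrow> ('i \<Rightarrow> real) measure" where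
  "normal_PiM I \<equiv> Pi\<^sub>M I (\<lambda>_. \<gamma>)"

interpretation \<gamma>s: product_prob_space "\<lambda>_. \<gamma>" I for I :: "'i set" ..

lemma normal_PiM_insert:
  assumes "finite J" "i \<notin> J"
  shows "normal_PiM (insert i J) = distr (normal_PiM J \<Otimes>\<^sub>M \<gamma>) (normal_PiM (insert i J)) (\<lambda>(x, y). x(i := y))"
    (is "_ = distr _ _ ?u")
proof (rule measure_eqI)
  fix A assume A[measurable]: "A \<in> sets (normal_PiM (insert i J))"
  have [measurable]: "?u \<in> measurable (normal_PiM J \<Otimes>\<^sub>M \<gamma>) (normal_PiM (insert i J))"
    by measurable
  have "emeasure (normal_PiM (insert i J)) A = (\<integral>\<^sup>+z. indicator A z \<partial>normal_PiM (insert i J))"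
    by simp
  also have "\<dots> = (\<integral>\<^sup>+x. \<integral>\<^sup>+y. indicator A (x(i := y)) \<partial>\<gamma> \<partial>normal_PiM J)"
    by (rule \<gamma>s.product_nn_integral_insert[OF assms]) measurable
  also have "\<dots> = (\<integral>\<^sup>+p. indicator A (?u p) \<partial>(normal_PiM J \<Otimes>\<^sub>M \<gamma>))"
    by (subst \<gamma>.nn_integral_fst[symmetric]) auto
  also have "\<dots> = emeasure (distr (normal_PiM J \<Otimes>\<^sub>M \<gamma>) (normal_PiM (insert i J)) ?u) A"
    by (subst nn_integral_indicator[symmetric], simp, subst nn_integral_distr) auto
  finally show "emeasure (normal_PiM (insert i J)) A = emeasure (distr (normal_PiM J \<Otimes>\<^sub>M \<gamma>) (normal_PiM (insert i J)) ?u) A" .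
qed simp

text \<open>This permits integration over one coordinate with the others fixed, without splitting
  the index set. The old value of the coordinate is overwritten, so that only the total mass 1 of
  its law enters.\<close>

lemma normal_PiM_resample:
  assumes "finite I" "i \<in> I"
  shows "distr (normal_PiM I \<Otimes>\<^sub>M \<gamma>) (normal_PiM I) (\<lambda>(z, y). z(i := y)) = normal_PiM I"
    (is "distr _ _ ?u = _")
proof (rule measure_eqI)
  define J where "J = I - {i}"
  have J: "finite J" "i \<notin> J" and I: "I = insert i J" using assms by (auto simp: J_def)
  fix A assume "A \<in> sets (distr (normal_PiM I \<Otimes>\<^sub>M \<gamma>) (normal_PiM I) ?u)"
  then have A[measurable]: "A \<in> sets (normal_PiM I)" by simp
  have [measurable]: "?u \<in> measurable (normal_PiM I \<Otimes>\<^sub>M \<gamma>) (normal_PiM I)"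
    using measurable_add_dim[of i I "\<lambda>_. \<gamma>"] assms by (simp add: insert_absorb)
  have "emeasure (distr (normal_PiM I \<Otimes>\<^sub>M \<gamma>) (normal_PiM I) ?u) A = (\<integral>\<^sup>+p. indicator A (?u p) \<partial>(normal_PiM I \<Otimes>\<^sub>M \<gamma>))"
    by (subst nn_integral_indicator[symmetric], simp, subst nn_integral_distr) auto
  also have "\<dots> = (\<integral>\<^sup>+z. \<integral>\<^sup>+y. indicator A (z(i := y)) \<partial>\<gamma> \<partial>normal_PiM I)"
    by (subst \<gamma>.nn_integral_fst[symmetric]) auto
  also have "\<dots> = (\<integral>\<^sup>+x. \<integral>\<^sup>+v. \<integral>\<^sup>+y. indicator A ((x(i := v))(i := y)) \<partial>\<gamma> \<partial>\<gamma> \<partial>normal_PiM J)"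
    unfolding I
    by (rule \<gamma>s.product_nn_integral_insert[OF J]) (unfold I[symmetric], measurable)
  also have "\<dots> = (\<integral>\<^sup>+x. \<integral>\<^sup>+y. indicator A (x(i := y)) \<partial>\<gamma> \<partial>normal_PiM J)"
    using \<gamma>.emeasure_space_1 by simp
  also have "\<dots> = (\<integral>\<^sup>+z. indicator A z \<partial>normal_PiM I)"
    unfolding I
    by (rule \<gamma>s.product_nn_integral_insert[OF J, symmetric]) (unfold I[symmetric], measurable)
  finally show "emeasure (distr (normal_PiM I \<Otimes>\<^sub>M \<gamma>) (normal_PiM I) ?u) A = emeasure (normal_PiM I) A"
    by simp
qed simp

section \<open>Triangular maps and the Knothe rearrangement\<close>

definition earlier :: "'i list \<Rightarrow> 'i \<Rightarrow> 'i set" where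
  "earlier is i = set (takeWhile (\<lambda>j. j \<noteq> i) is)"

text \<open>
  \<open>c i z\<close> is the conditional density of the \<open>i\<close>-th coordinate of the image given the earlier ones,
  expressed as a function of the source point \<open>z\<close>.
\<close>

definition triangular :: "'i list \<Rightarrow> ('i \<Rightarrow> ('i \<Rightarrow> real) \<Rightarrow> real \<Rightarrow> real) \<Rightarrow> bool" where
  "triangular is c \<longleftrightarrow> (\<forall>i\<in>set is.
     (\<lambda>(z, y). c i z y) \<in> borel_measurable (normal_PiM (set is) \<Otimes>\<^sub>M borel) \<and>
     (\<forall>z\<in>space (normal_PiM (set is)). gauss_density (c i z)) \<and>
     (\<forall>z z'. (\<forall>j\<in>earlier is i. z j = z' j) \<longrightarrow> c i z = c i z'))"

definition triangular_map :: "'i list \<Rightarrow> ('i \<Rightarrow> ('i \<Rightarrow> real) \<Rightarrow> real \<Rightarrow> real) \<Rightarrow> ('i \<Rightarrow> real) \<Rightarrow> 'i \<Rightarrow> real" where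
  "triangular_map is c z = (\<lambda>i\<in>set is. quantile (c i z) (z i))"

lemma triangular_quantile_measurable:
  assumes "triangular is c" "i \<in> set is"
  shows "(\<lambda>(z, y). quantile (c i z) y) \<in> borel_measurable (normal_PiM (set is) \<Otimes>\<^sub>M borel)"
  using assms by (intro measurable_quantile_param) (auto simp: triangular_def)

lemma triangular_map_measurable:
  assumes "triangular is c"
  shows "triangular_map is c \<in> measurable (normal_PiM (set is)) (normal_PiM (set is))"
  unfolding triangular_map_def
proof (rule measurable_restrict)
  fix i assume i: "i \<in> set is"
  note [measurable] = triangular_quantile_measurable[OF assms i]
  have [measurable]: "(\<lambda>z. z i) \<in> borel_measurable (normal_PiM (set is))"
    using measurable_component_singleton[OF i, of "\<lambda>_. \<gamma>"] by simp
  have "(\<lambda>z. (\<lambda>(z, y). quantile (c i z) y) (z, z i)) \<in> borel_measurable (normal_PiM (set is))"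
    by measurable
  then show "(\<lambda>z. quantile (c i z) (z i)) \<in> measurable (normal_PiM (set is)) \<gamma>" by simp
qed

lemma triangular_rel_ent_measurable:
  assumes "triangular is c" "i \<in> set is"
  shows "(\<lambda>z. rel_ent \<gamma> (c i z)) \<in> borel_measurable (normal_PiM (set is))"
proof -
  have [measurable]: "(\<lambda>(z, y). c i z y) \<in> borel_measurable (normal_PiM (set is) \<Otimes>\<^sub>M borel)"
    using assms by (simp add: triangular_def)
  show ?thesis unfolding rel_ent_def by measurable
qed

text \<open>Induction that appends a last coordinate to the list. The density is viewed as fibred
  over the earlier coordinates, the induction hypothesis is applied to its marginal, and
  \<open>rel_ent_chain\<close> accounts for the entropy of the new coordinate.\<close>

lemma Knothe_rearrangement:
  fixes "is" :: "'i list" and f :: "('i \<Rightarrow> real) \<Rightarrow> real"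
  assumes "distinct is" and "f \<in> borel_measurable (normal_PiM (set is))" and "\<And>x. 0 \<le> f x"
    and "(\<integral>\<^sup>+x. ennreal (f x) \<partial>normal_PiM (set is)) = 1"
  shows "\<exists>c. triangular is c \<and>
    distr (normal_PiM (set is)) (normal_PiM (set is)) (triangular_map is c) = density (normal_PiM (set is)) f \<and>
    (\<Sum>i\<in>set is. \<integral>\<^sup>+z. rel_ent \<gamma> (c i z) \<partial>normal_PiM (set is)) \<le> rel_ent (normal_PiM (set is)) f"
  using assms
proof (induction "is" arbitrary: f rule: rev_induct)
  case Nil
  let ?c = "\<lambda>_ _ _. 1 :: real"
  have e: "normal_PiM {} = count_space {\<lambda>k. undefined}" by (rule PiM_empty)
  \<comment> \<open>The empty product is a point mass, so total mass 1 determines \<open>f\<close>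
    at the only point.\<close>
  have "f (\<lambda>k. undefined) = 1"
    using Nil(4) by (simp add: e nn_integral_count_space_finite)
  have "distr (normal_PiM {}) (normal_PiM {}) (triangular_map [] ?c) = distr (normal_PiM {}) (normal_PiM {}) (\<lambda>z. z)"
    by (intro distr_cong refl) (auto simp: triangular_map_def space_PiM)
  also have "\<dots> = density (normal_PiM {}) (\<lambda>x. 1)"
    by (simp add: distr_id density_1)
  also have "\<dots> = density (normal_PiM {}) f"
    using \<open>f (\<lambda>k. undefined) = 1\<close> by (intro density_cong) (auto simp: e intro!: AE_I2)
  finally show ?case
    by (intro exI[of _ ?c]) (simp add: triangular_def)
next
  case (snoc i js)
  define J where "J = set js"
  have J: "finite J" "i \<notin> J" and sI: "set (js @ [i]) = insert i J"
    using snoc.prems(1) by (auto simp: J_def)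
  let ?I = "insert i J"
  let ?u = "\<lambda>(x, y). x(i := y) :: 'i \<Rightarrow> real"
  have u[measurable]: "?u \<in> measurable (normal_PiM J \<Otimes>\<^sub>M \<gamma>) (normal_PiM ?I)"
    by (rule measurable_add_dim)
  have PI: "normal_PiM ?I = distr (normal_PiM J \<Otimes>\<^sub>M \<gamma>) (normal_PiM ?I) ?u"
    by (rule normal_PiM_insert[OF J])
  have f[measurable]: "f \<in> borel_measurable (normal_PiM ?I)"
    using snoc.prems(2) by (simp only: sI)
  define g where "g = (\<lambda>p. f (?u p))"
  have g: "g \<in> borel_measurable (normal_PiM J \<Otimes>\<^sub>M \<gamma>)"
    unfolding g_def by measurable
  have sets_pair: "sets (normal_PiM J \<Otimes>\<^sub>M \<gamma>) = sets (normal_PiM J \<Otimes>\<^sub>M borel)"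
    by (intro sets_pair_measure_cong) auto
  interpret g: fibred_density "normal_PiM J" g
  proof
    show "g \<in> borel_measurable (normal_PiM J \<Otimes>\<^sub>M borel)"
      using g measurable_cong_sets[OF sets_pair refl] by blast
    show "0 \<le> g p" for p using snoc.prems(3) by (simp add: g_def)
    have "(\<integral>\<^sup>+p. ennreal (g p) \<partial>(normal_PiM J \<Otimes>\<^sub>M \<gamma>)) = (\<integral>\<^sup>+x. ennreal (f x) \<partial>normal_PiM ?I)"
      unfolding g_def by (subst PI, subst nn_integral_distr) auto
    then show "(\<integral>\<^sup>+p. ennreal (g p) \<partial>(normal_PiM J \<Otimes>\<^sub>M \<gamma>)) = 1"
      using snoc.prems(4) by (simp only: sI)
  qed
  have "\<exists>c. triangular js c \<and>
    distr (normal_PiM J) (normal_PiM J) (triangular_map js c) = density (normal_PiM J) (marginal g) \<and>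
    (\<Sum>i\<in>J. \<integral>\<^sup>+z. rel_ent \<gamma> (c i z) \<partial>normal_PiM J) \<le> rel_ent (normal_PiM J) (marginal g)"
    unfolding J_def
    by (rule snoc.IH) (use snoc.prems(1) g.measurable_marginal g.marginal_nonneg g.total_marginal in \<open>auto simp: J_def\<close>)
  then obtain c where c: "triangular js c"
    and cd: "distr (normal_PiM J) (normal_PiM J) (triangular_map js c) = density (normal_PiM J) (marginal g)"
    and ce: "(\<Sum>i\<in>J. \<integral>\<^sup>+z. rel_ent \<gamma> (c i z) \<partial>normal_PiM J) \<le> rel_ent (normal_PiM J) (marginal g)"
    by blast
  define T where "T = triangular_map js c"
  have T[measurable]: "T \<in> measurable (normal_PiM J) (normal_PiM J)"
    using triangular_map_measurable[OF c] by (simp add: T_def J_def)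
  \<comment> \<open>The conditional density is taken at the image under \<open>T\<close> of the
    earlier coordinates, which makes it a function of the source point. The restriction lands in the
    space of \<open>normal_PiM J\<close> and shows that only the coordinates in \<open>J\<close>
    matter.\<close>
  define c' where "c' j z = (if j = i then conditional g (T (restrict z J)) else c j (restrict z J))" for j z
  have r[measurable]: "(\<lambda>z. restrict z J) \<in> measurable (normal_PiM ?I) (normal_PiM J)"
    by (rule measurable_restrict_subset) auto
  have tri: "triangular (js @ [i]) c'"
    unfolding triangular_def sI
  proof (intro ballI conjI allI impI)
    fix j assume j: "j \<in> ?I"
    show "(\<lambda>(z, y). c' j z y) \<in> borel_measurable (normal_PiM ?I \<Otimes>\<^sub>M borel)"
    proof (cases "j = i")
      case True
      note [measurable] = g.measurable_conditional
      have "(\<lambda>p. (\<lambda>(x, y). conditional g x y) (T (restrict (fst p) J), snd p)) \<in> borel_measurable (normal_PiM ?I \<Otimes>\<^sub>M borel)"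
        by measurable
      then show ?thesis using True by (simp add: c'_def case_prod_beta)
    next
      case False
      with j c have [measurable]: "(\<lambda>(z, y). c j z y) \<in> borel_measurable (normal_PiM J \<Otimes>\<^sub>M borel)"
        by (auto simp: triangular_def J_def)
      have "(\<lambda>p. (\<lambda>(x, y). c j x y) (restrict (fst p) J, snd p)) \<in> borel_measurable (normal_PiM ?I \<Otimes>\<^sub>M borel)"
        by measurable
      then show ?thesis using False by (simp add: c'_def case_prod_beta)
    qed
  next
    fix j z assume j: "j \<in> ?I" and z: "z \<in> space (normal_PiM ?I)"
    have rz: "restrict z J \<in> space (normal_PiM J)" by (rule measurable_space[OF r z])
    show "gauss_density (c' j z)"
      using c j g.gauss_density_conditional[OF measurable_space[OF T rz]] rz
      by (auto simp: c'_def triangular_def J_def)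
  next
    fix j and z z' :: "'i \<Rightarrow> real" assume j: "j \<in> ?I" and z: "\<forall>k\<in>earlier (js @ [i]) j. z k = z' k"
    show "c' j z = c' j z'"
    proof (cases "j = i")
      case True
      have "earlier (js @ [i]) i = J"
        using J unfolding earlier_def J_def by (subst takeWhile_append2) auto
      with z True have "restrict z J = restrict z' J" by (auto simp: fun_eq_iff)
      then show ?thesis using True by (simp add: c'_def)
    next
      case False
      with j have "j \<in> set js" by (simp add: J_def)
      then have e: "earlier (js @ [i]) j = earlier js j"
        by (simp add: earlier_def)
      have "earlier js j \<subseteq> J" by (auto simp: earlier_def J_def dest: set_takeWhileD)
      with z e have "\<forall>k\<in>earlier js j. restrict z J k = restrict z' J k" by auto
      then show ?thesis using c \<open>j \<in> set js\<close> False unfolding triangular_def c'_def by auto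
    qed
  qed
  note M' = triangular_map_measurable[OF tri, unfolded sI]
  have "distr (normal_PiM ?I) (normal_PiM ?I) (triangular_map (js @ [i]) c')
    = distr (normal_PiM J \<Otimes>\<^sub>M \<gamma>) (normal_PiM ?I) (triangular_map (js @ [i]) c' \<circ> ?u)"
    by (subst (1) PI, rule distr_distr[OF M' u])
  \<comment> \<open>When points over \<open>?I\<close> are written as pairs, the new triangular map
    becomes the map of \<open>distr_quantile_conditional\<close>.\<close>
  also have "\<dots> = distr (normal_PiM J \<Otimes>\<^sub>M \<gamma>) (normal_PiM ?I)
      (?u \<circ> (\<lambda>(w, z). (T w, quantile (conditional g (T w)) z)))"
  proof (intro distr_cong refl)
    fix p assume "p \<in> space (normal_PiM J \<Otimes>\<^sub>M \<gamma>)"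
    then obtain x y where p: "p = (x, y)" and x: "x \<in> space (normal_PiM J)"
      by (auto simp: space_pair_measure)
    have rx: "restrict (x(i := y)) J = x"
      using x J by (auto simp: space_PiM PiE_def extensional_def fun_eq_iff)
    show "(triangular_map (js @ [i]) c' \<circ> ?u) p = (?u \<circ> (\<lambda>(w, z). (T w, quantile (conditional g (T w)) z))) p"
    proof
      have Tx: "T x = (\<lambda>j\<in>J. quantile (c j x) (x j))"
        by (simp add: T_def triangular_map_def J_def)
      fix j show "(triangular_map (js @ [i]) c' \<circ> ?u) p j = (?u \<circ> (\<lambda>(w, z). (T w, quantile (conditional g (T w)) z))) p j"
        unfolding p comp_def case_prod_conv triangular_map_def[of "js @ [i]"] sI
        using J by (cases "j = i") (auto simp: c'_def rx Tx)
    qed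
  qed
  also have "\<dots> = distr (distr (normal_PiM J \<Otimes>\<^sub>M \<gamma>) (normal_PiM J \<Otimes>\<^sub>M \<gamma>)
       (\<lambda>(w, z). (T w, quantile (conditional g (T w)) z))) (normal_PiM ?I) ?u"
  proof (rule distr_distr[symmetric, OF u])
    have Q[measurable]: "(\<lambda>(x, z). quantile (conditional g x) z) \<in> borel_measurable (normal_PiM J \<Otimes>\<^sub>M borel)"
      by (intro measurable_quantile_param g.measurable_conditional g.gauss_density_conditional)
    note [measurable_cong] = sets_pair
    show "(\<lambda>(w, z). (T w, quantile (conditional g (T w)) z)) \<in> measurable (normal_PiM J \<Otimes>\<^sub>M \<gamma>) (normal_PiM J \<Otimes>\<^sub>M \<gamma>)"
      by measurable
  qed
  also have "\<dots> = distr (density (normal_PiM J \<Otimes>\<^sub>M \<gamma>) g) (normal_PiM ?I) ?u"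
    using g.distr_quantile_conditional[OF T] cd by (simp add: T_def)
  also have "\<dots> = density (normal_PiM ?I) f"
  proof -
    have "density (distr (normal_PiM J \<Otimes>\<^sub>M \<gamma>) (normal_PiM ?I) ?u) f
      = distr (density (normal_PiM J \<Otimes>\<^sub>M \<gamma>) g) (normal_PiM ?I) ?u"
      unfolding g_def by (rule density_distr) measurable
    then show ?thesis unfolding PI[symmetric] by (rule sym)
  qed
  finally have di: "distr (normal_PiM ?I) (normal_PiM ?I) (triangular_map (js @ [i]) c') = density (normal_PiM ?I) f" .
  have [measurable]: "(\<lambda>x. rel_ent \<gamma> (conditional g x)) \<in> borel_measurable (normal_PiM J)"
    unfolding rel_ent_def using g.measurable_conditional by measurable
  have rI: "(\<integral>\<^sup>+z. h (restrict z J) \<partial>normal_PiM ?I) = (\<integral>\<^sup>+x. h x \<partial>normal_PiM J)"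
    if [measurable]: "h \<in> borel_measurable (normal_PiM J)" for h :: "('i \<Rightarrow> real) \<Rightarrow> ennreal"
    using J by (subst \<gamma>s.distr_PiM_restrict_finite[symmetric, of J ?I]) (auto simp: nn_integral_distr)
  have "(\<Sum>j\<in>?I. \<integral>\<^sup>+z. rel_ent \<gamma> (c' j z) \<partial>normal_PiM ?I) =
    (\<integral>\<^sup>+z. rel_ent \<gamma> (c' i z) \<partial>normal_PiM ?I) + (\<Sum>j\<in>J. \<integral>\<^sup>+z. rel_ent \<gamma> (c' j z) \<partial>normal_PiM ?I)"
    using J by simp
  also have "(\<integral>\<^sup>+z. rel_ent \<gamma> (c' i z) \<partial>normal_PiM ?I) = (\<integral>\<^sup>+x. rel_ent \<gamma> (conditional g (T x)) \<partial>normal_PiM J)"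
    unfolding c'_def by (simp, rule rI) measurable
  \<comment> \<open>The image law under \<open>T\<close> has density \<open>marginal g\<close>. The
    average over source points thereby acquires the weight that occurs in
    \<open>rel_ent_chain\<close>.\<close>
  also have "\<dots> = (\<integral>\<^sup>+x. rel_ent \<gamma> (conditional g x) \<partial>density (normal_PiM J) (marginal g))"
    unfolding cd[symmetric] T_def[symmetric] by (subst nn_integral_distr) auto
  also have "\<dots> = (\<integral>\<^sup>+x. ennreal (marginal g x) * rel_ent \<gamma> (conditional g x) \<partial>normal_PiM J)"
    by (rule nn_integral_density) auto
  also have "(\<Sum>j\<in>J. \<integral>\<^sup>+z. rel_ent \<gamma> (c' j z) \<partial>normal_PiM ?I) = (\<Sum>j\<in>J. \<integral>\<^sup>+z. rel_ent \<gamma> (c j z) \<partial>normal_PiM J)"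
  proof (rule sum.cong[OF refl])
    fix j assume j: "j \<in> J"
    with J have "j \<noteq> i" by auto
    with rI[of "\<lambda>z. rel_ent \<gamma> (c j z)"] triangular_rel_ent_measurable[OF c, of j] j
    show "(\<integral>\<^sup>+z. rel_ent \<gamma> (c' j z) \<partial>normal_PiM ?I) = (\<integral>\<^sup>+z. rel_ent \<gamma> (c j z) \<partial>normal_PiM J)"
      by (simp add: c'_def J_def)
  qed
  also have "(\<integral>\<^sup>+x. ennreal (marginal g x) * rel_ent \<gamma> (conditional g x) \<partial>normal_PiM J) +
      (\<Sum>j\<in>J. \<integral>\<^sup>+z. rel_ent \<gamma> (c j z) \<partial>normal_PiM J)
    \<le> rel_ent (normal_PiM J) (marginal g) + (\<integral>\<^sup>+x. ennreal (marginal g x) * rel_ent \<gamma> (conditional g x) \<partial>normal_PiM J)"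
    using ce by (subst add.commute) (rule add_right_mono)
  also have "\<dots> \<le> rel_ent (normal_PiM J \<Otimes>\<^sub>M \<gamma>) g"
    by (rule g.rel_ent_chain)
  also have "\<dots> = rel_ent (normal_PiM ?I) f"
  proof -
    have "rel_ent (distr (normal_PiM J \<Otimes>\<^sub>M \<gamma>) (normal_PiM ?I) ?u) f = rel_ent (normal_PiM J \<Otimes>\<^sub>M \<gamma>) g"
      unfolding rel_ent_def g_def by (rule nn_integral_distr) measurable
    then show ?thesis unfolding PI[symmetric] by (rule sym)
  qed
  finally have "(\<Sum>j\<in>?I. \<integral>\<^sup>+z. rel_ent \<gamma> (c' j z) \<partial>normal_PiM ?I) \<le> rel_ent (normal_PiM ?I) f" .
  with tri di show ?case unfolding sI by blast
qed

subsection \<open>The cost of the coupling\<close>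

lemma prob_space_normal_PiM: "prob_space (normal_PiM I)"
  by (rule prob_space_PiM) (rule \<gamma>.prob_space_axioms)

text \<open>By \<open>normal_PiM_resample\<close>, \<open>h\<close> may be evaluated at the
  resampled point; Fubini's theorem for the product with the fresh coordinate gives all three
  claims.\<close>

lemma normal_PiM_resample_integral:
  fixes h :: "('i \<Rightarrow> real) \<Rightarrow> real"
  assumes I: "finite I" "i \<in> I" and h: "integrable (normal_PiM I) h"
  shows "AE z in normal_PiM I. integrable \<gamma> (\<lambda>y. h (z(i := y)))"
    and "integrable (normal_PiM I) (\<lambda>z. \<integral>y. h (z(i := y)) \<partial>\<gamma>)"
    and "(\<integral>z. \<integral>y. h (z(i := y)) \<partial>\<gamma> \<partial>normal_PiM I) = (\<integral>z. h z \<partial>normal_PiM I)"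
proof -
  interpret pair_prob_space "normal_PiM I" \<gamma> ..
  let ?u = "\<lambda>(z, y). z(i := y) :: 'i \<Rightarrow> real"
  have u: "?u \<in> measurable (normal_PiM I \<Otimes>\<^sub>M \<gamma>) (normal_PiM I)"
    using measurable_add_dim[of i I "\<lambda>_. \<gamma>"] I by (simp add: insert_absorb)
  have hm: "h \<in> borel_measurable (normal_PiM I)" using h by auto
  have "integrable (distr (normal_PiM I \<Otimes>\<^sub>M \<gamma>) (normal_PiM I) ?u) h"
    using h by (simp only: normal_PiM_resample[OF I])
  then have hu: "integrable (normal_PiM I \<Otimes>\<^sub>M \<gamma>) (\<lambda>p. h (?u p))"
    by (subst (asm) integrable_distr_eq[OF u hm])
  have "(\<integral>z. h z \<partial>normal_PiM I) = (\<integral>z. h z \<partial>distr (normal_PiM I \<Otimes>\<^sub>M \<gamma>) (normal_PiM I) ?u)"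
    by (simp only: normal_PiM_resample[OF I])
  also have "\<dots> = (\<integral>p. h (?u p) \<partial>(normal_PiM I \<Otimes>\<^sub>M \<gamma>))"
    by (rule integral_distr[OF u hm])
  finally show "(\<integral>z. \<integral>y. h (z(i := y)) \<partial>\<gamma> \<partial>normal_PiM I) = (\<integral>z. h z \<partial>normal_PiM I)"
    using integral_fst'[OF hu] by simp
  show "AE z in normal_PiM I. integrable \<gamma> (\<lambda>y. h (z(i := y)))"
    using AE_integrable_fst'[OF hu] by simp
  show "integrable (normal_PiM I) (\<lambda>z. \<integral>y. h (z(i := y)) \<partial>\<gamma>)"
    using integrable_fst'[OF hu] by simp
qed

lemma indep_vars_normal_PiM:
  assumes "finite I" "I \<noteq> {}"
  shows "prob_space.indep_vars (normal_PiM I) (\<lambda>_. \<gamma>) (\<lambda>i z. z i) I"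
proof -
  have "distr (normal_PiM I) (normal_PiM I) (\<lambda>z. \<lambda>i\<in>I. z i) = distr (normal_PiM I) (normal_PiM I) (\<lambda>z. z)"
    by (intro distr_cong refl) (auto simp: space_PiM)
  then have "distr (normal_PiM I) (normal_PiM I) (\<lambda>z. \<lambda>i\<in>I. z i) = normal_PiM I" by (simp add: distr_id)
  moreover have "PiM I (\<lambda>i. distr (normal_PiM I) \<gamma> (\<lambda>z. z i)) = normal_PiM I"
    by (intro PiM_cong refl \<gamma>s.PiM_component) auto
  ultimately show ?thesis
    using assms by (subst prob_space.indep_vars_iff_distr_eq_PiM'[OF prob_space_normal_PiM]) auto
qed

text \<open>Functions of disjoint blocks of independent coordinates are independent.\<close>

lemma normal_PiM_integral_mult:
  fixes a b :: "('i \<Rightarrow> real) \<Rightarrow> real"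
  assumes "finite I" "I \<noteq> {}" and J: "J \<subseteq> I" and K: "K \<subseteq> I" and JK: "J \<inter> K = {}"
    and a: "integrable (normal_PiM I) a" and aJ: "\<And>z z'. (\<And>j. j \<in> J \<Longrightarrow> z j = z' j) \<Longrightarrow> a z = a z'"
    and b: "integrable (normal_PiM I) b" and bK: "\<And>z z'. (\<And>j. j \<in> K \<Longrightarrow> z j = z' j) \<Longrightarrow> b z = b z'"
  shows "integrable (normal_PiM I) (\<lambda>z. a z * b z)"
    and "(\<integral>z. a z * b z \<partial>normal_PiM I) = (\<integral>z. a z \<partial>normal_PiM I) * (\<integral>z. b z \<partial>normal_PiM I)"
proof -
  \<comment> \<open>\<open>e L\<close> extends a point over \<open>L\<close> to a point over
    \<open>I\<close> by zeros. It exhibits \<open>a\<close> and \<open>b\<close> as measurable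
    functions of the restrictions of \<open>z\<close> to \<open>J\<close> and to
    \<open>K\<close>.\<close>
  define e where "e L w = (\<lambda>i\<in>I. if i \<in> L then w i else 0 :: real)" for L and w :: "'i \<Rightarrow> real"
  have e: "e L \<in> measurable (normal_PiM L) (normal_PiM I)" for L
    unfolding e_def
  proof (rule measurable_restrict)
    fix i show "(\<lambda>w. if i \<in> L then w i else 0) \<in> measurable (normal_PiM L) \<gamma>"
      using measurable_component_singleton[of i L "\<lambda>_. \<gamma>"] by (cases "i \<in> L") auto
  qed
  have ae: "a \<circ> e J \<in> borel_measurable (normal_PiM J)"
    using a by (intro measurable_comp[OF e]) auto
  have be: "b \<circ> e K \<in> borel_measurable (normal_PiM K)"
    using b by (intro measurable_comp[OF e]) auto
  have "prob_space.indep_var (normal_PiM I) (normal_PiM J) (\<lambda>z. restrict (\<lambda>i. z i) J) (normal_PiM K) (\<lambda>z. restrict (\<lambda>i. z i) K)"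
    using JK J K by (rule prob_space.indep_var_restrict[OF prob_space_normal_PiM indep_vars_normal_PiM[OF assms(1,2)]])
  then have "prob_space.indep_var (normal_PiM I) borel ((a \<circ> e J) \<circ> (\<lambda>z. restrict z J)) borel ((b \<circ> e K) \<circ> (\<lambda>z. restrict z K))"
    by (rule prob_space.indep_var_compose[OF prob_space_normal_PiM]) (fact ae be)+
  moreover have "(a \<circ> e J) \<circ> (\<lambda>z. restrict z J) = a"
    unfolding comp_def by (rule ext, rule aJ) (use J in \<open>auto simp: e_def\<close>)
  moreover have "(b \<circ> e K) \<circ> (\<lambda>z. restrict z K) = b"
    unfolding comp_def by (rule ext, rule bK) (use K in \<open>auto simp: e_def\<close>)
  ultimately have "prob_space.indep_var (normal_PiM I) borel a borel b" by simp
  then show "integrable (normal_PiM I) (\<lambda>z. a z * b z)"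
    and "(\<integral>z. a z * b z \<partial>normal_PiM I) = (\<integral>z. a z \<partial>normal_PiM I) * (\<integral>z. b z \<partial>normal_PiM I)"
    using a b by (auto intro: prob_space.indep_var_integrable[OF prob_space_normal_PiM] prob_space.indep_var_lebesgue_integral[OF prob_space_normal_PiM])
qed

section \<open>One coordinate of the coupling\<close>

lemma not_in_earlier: "i \<notin> earlier is i"
  by (auto simp: earlier_def dest: set_takeWhileD)

lemma earlier_subset: "earlier is i \<subseteq> set is"
  by (auto simp: earlier_def dest: set_takeWhileD)

text \<open>For \<open>is = xs @ i # ys\<close> the two sets are those of \<open>xs\<close> and of
  \<open>ys\<close>. This disjointness is the reason for building the two maps in opposite
  orders.\<close>

lemma earlier_rev_disjoint:
  assumes "distinct is" "i \<in> set is"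
  shows "earlier is i \<inter> earlier (rev is) i = {}"
proof -
  obtain xs ys where is': "is = xs @ i # ys" using assms(2) by (auto simp: in_set_conv_decomp)
  have "takeWhile (\<lambda>j. j \<noteq> i) is = xs" "takeWhile (\<lambda>j. j \<noteq> i) (rev is) = rev ys"
    using assms(1) unfolding is' by (auto simp: takeWhile_append)
  then show ?thesis using assms(1) by (auto simp: earlier_def is')
qed

lemma triangular_cong:
  assumes "triangular is c" "i \<in> set is" "\<And>j. j \<in> earlier is i \<Longrightarrow> z j = z' j"
  shows "c i z = c i z'"
proof -
  have "(\<forall>j\<in>earlier is i. z j = z' j) \<longrightarrow> c i z = c i z'"
    using assms(1,2) unfolding triangular_def by simp
  then show ?thesis using assms(3) by simp
qed

text \<open>\<open>c i\<close> does not look at coordinate \<open>i\<close> itself, so changing that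
  coordinate only changes the argument of the quantile map.\<close>

lemma triangular_map_upd:
  assumes "triangular is c" "i \<in> set is"
  shows "triangular_map is c (z(i := y)) i = quantile (c i z) y"
proof -
  have "c i (z(i := y)) = c i z"
    using not_in_earlier[of i "is"] by (intro triangular_cong[OF assms]) auto
  then show ?thesis using assms(2) by (simp add: triangular_map_def)
qed

text \<open>This provides what the inequality on the line requires of almost every conditional law.
  Resampling coordinate \<open>i\<close> yields the second moments and the means; a finite average
  entropy yields finite entropy almost everywhere.\<close>

lemma triangular_coordinate:
  assumes c: "triangular is c" and i: "i \<in> set is"
    and sq: "integrable (normal_PiM (set is)) (\<lambda>z. (triangular_map is c z i)\<^sup>2)"
    and ent: "(\<integral>\<^sup>+z. rel_ent \<gamma> (c i z) \<partial>normal_PiM (set is)) < \<infinity>"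
  shows "AE z in normal_PiM (set is). gauss_density (c i z) \<and>
      integrable \<gamma> (\<lambda>y. (quantile (c i z) y)\<^sup>2) \<and> rel_ent \<gamma> (c i z) < \<infinity>"
    and "integrable (normal_PiM (set is)) (\<lambda>z. enn2real (rel_ent \<gamma> (c i z)))"
    and "(\<integral>z. enn2real (rel_ent \<gamma> (c i z)) \<partial>normal_PiM (set is)) = enn2real (\<integral>\<^sup>+z. rel_ent \<gamma> (c i z) \<partial>normal_PiM (set is))"
    and "integrable (normal_PiM (set is)) (\<lambda>z. triangular_map is c z i)"
    and "integrable (normal_PiM (set is)) (\<lambda>z. \<integral>y. quantile (c i z) y \<partial>\<gamma>)"
    and "(\<integral>z. \<integral>y. quantile (c i z) y \<partial>\<gamma> \<partial>normal_PiM (set is)) = (\<integral>z. triangular_map is c z i \<partial>normal_PiM (set is))"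
proof -
  let ?P = "normal_PiM (set is)"
  note [measurable] = triangular_rel_ent_measurable[OF c i]
  have fin: "AE z in ?P. rel_ent \<gamma> (c i z) \<noteq> \<infinity>"
    using ent by (intro nn_integral_PInf_AE) auto
  have eq: "(\<integral>\<^sup>+z. ennreal (enn2real (rel_ent \<gamma> (c i z))) \<partial>?P) = (\<integral>\<^sup>+z. rel_ent \<gamma> (c i z) \<partial>?P)"
    by (rule nn_integral_cong_AE, use fin in eventually_elim) (simp add: less_top)
  show "integrable ?P (\<lambda>z. enn2real (rel_ent \<gamma> (c i z)))"
    by (rule integrableI_nonneg) (use eq ent in auto)
  show "(\<integral>z. enn2real (rel_ent \<gamma> (c i z)) \<partial>?P) = enn2real (\<integral>\<^sup>+z. rel_ent \<gamma> (c i z) \<partial>?P)"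
    by (subst integral_eq_nn_integral) (auto simp: eq)
  have m: "(\<lambda>z. triangular_map is c z i) \<in> borel_measurable ?P"
    using measurable_comp[OF triangular_map_measurable[OF c] measurable_component_singleton[OF i, of "\<lambda>_. \<gamma>"]]
    by (simp add: comp_def)
  show int: "integrable ?P (\<lambda>z. triangular_map is c z i)"
    by (rule finite_measure.square_integrable_imp_integrable[OF prob_space.finite_measure[OF prob_space_normal_PiM] m sq])
  show "integrable ?P (\<lambda>z. \<integral>y. quantile (c i z) y \<partial>\<gamma>)"
    "(\<integral>z. \<integral>y. quantile (c i z) y \<partial>\<gamma> \<partial>?P) = (\<integral>z. triangular_map is c z i \<partial>?P)"
    using normal_PiM_resample_integral(2,3)[OF finite_set i int] unfolding triangular_map_upd[OF c i] by auto
  have "AE z in ?P. integrable \<gamma> (\<lambda>y. (quantile (c i z) y)\<^sup>2)"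
    using normal_PiM_resample_integral(1)[OF finite_set i sq] unfolding triangular_map_upd[OF c i] .
  with fin AE_space show "AE z in ?P. gauss_density (c i z) \<and>
      integrable \<gamma> (\<lambda>y. (quantile (c i z) y)\<^sup>2) \<and> rel_ent \<gamma> (c i z) < \<infinity>"
    by eventually_elim (use c i in \<open>auto simp: triangular_def less_top\<close>)
qed

text \<open>With all other coordinates fixed, both components are quantile maps evaluated at the
  same Gaussian variable, so that \<open>symmetrized_Talagrand_line\<close> applies; the result is
  averaged over the other coordinates.\<close>

lemma symmetrized_Talagrand_coordinate:
  fixes "is" :: "'i list"
  assumes "distinct is" and i: "i \<in> set is"
    and c: "triangular is c" and d: "triangular (rev is) d"
    and S: "integrable (normal_PiM (set is)) (\<lambda>z. (triangular_map is c z i)\<^sup>2)"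
    and T: "integrable (normal_PiM (set is)) (\<lambda>z. (triangular_map (rev is) d z i)\<^sup>2)"
    and ec: "(\<integral>\<^sup>+z. rel_ent \<gamma> (c i z) \<partial>normal_PiM (set is)) < \<infinity>"
    and ed: "(\<integral>\<^sup>+z. rel_ent \<gamma> (d i z) \<partial>normal_PiM (set is)) < \<infinity>"
    and centered: "(\<integral>z. triangular_map is c z i \<partial>normal_PiM (set is)) = 0"
  shows "integrable (normal_PiM (set is)) (\<lambda>z. (triangular_map is c z i - triangular_map (rev is) d z i)\<^sup>2)"
    and "(\<integral>z. (triangular_map is c z i - triangular_map (rev is) d z i)\<^sup>2 \<partial>normal_PiM (set is)) \<le>
      2 * enn2real (\<integral>\<^sup>+z. rel_ent \<gamma> (c i z) \<partial>normal_PiM (set is)) + 2 * enn2real (\<integral>\<^sup>+z. rel_ent \<gamma> (d i z) \<partial>normal_PiM (set is))"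
proof -
  let ?P = "normal_PiM (set is)"
  have i': "i \<in> set (rev is)" using i by simp
  note C = triangular_coordinate[OF c i S ec]
  note D = triangular_coordinate[OF d i', unfolded set_rev, OF T ed]
  \<comment> \<open>The conditional means of the two components given all coordinates but the
    \<open>i\<close>-th.\<close>
  define a where "a z = (\<integral>y. quantile (c i z) y \<partial>\<gamma>)" for z
  define b where "b z = (\<integral>y. quantile (d i z) y \<partial>\<gamma>)" for z
  have aJ: "a z = a z'" if "\<And>j. j \<in> earlier is i \<Longrightarrow> z j = z' j" for z z'
    unfolding a_def by (subst triangular_cong[OF c i that]) auto
  have bK: "b z = b z'" if "\<And>j. j \<in> earlier (rev is) i \<Longrightarrow> z j = z' j" for z z'
    unfolding b_def by (subst triangular_cong[OF d i' that]) auto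
  have int_a: "integrable ?P a" and int_b: "integrable ?P b"
    unfolding a_def[abs_def] b_def[abs_def] by (fact C(5) D(5))+
  have ne: "set is \<noteq> {}" using i by auto
  have sub: "earlier (rev is) i \<subseteq> set is" using earlier_subset[of "rev is"] by simp
  note ab = normal_PiM_integral_mult[OF finite_set ne earlier_subset sub
      earlier_rev_disjoint[OF assms(1) i] int_a aJ int_b bK]
  have m: "(\<lambda>z. triangular_map is c z i) \<in> borel_measurable ?P" "(\<lambda>z. triangular_map (rev is) d z i) \<in> borel_measurable ?P"
    using C(4) D(4) by auto
  show int: "integrable ?P (\<lambda>z. (triangular_map is c z i - triangular_map (rev is) d z i)\<^sup>2)"
    unfolding power2_diff using S T integrable_square_imp_integrable_mult[OF m S T]
    by (simp add: mult.assoc)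
  note R = normal_PiM_resample_integral[OF finite_set i int, unfolded triangular_map_upd[OF c i] triangular_map_upd[OF d i']]
  have "(\<integral>z. (triangular_map is c z i - triangular_map (rev is) d z i)\<^sup>2 \<partial>?P)
     = (\<integral>z. \<integral>y. (quantile (c i z) y - quantile (d i z) y)\<^sup>2 \<partial>\<gamma> \<partial>?P)"
    by (rule R(3)[symmetric])
  also have "\<dots> \<le> (\<integral>z. 2 * enn2real (rel_ent \<gamma> (c i z)) + 2 * enn2real (rel_ent \<gamma> (d i z)) - 2 * (a z * b z) \<partial>?P)"
  proof (rule integral_mono_AE)
    show "AE z in ?P. (\<integral>y. (quantile (c i z) y - quantile (d i z) y)\<^sup>2 \<partial>\<gamma>)
       \<le> 2 * enn2real (rel_ent \<gamma> (c i z)) + 2 * enn2real (rel_ent \<gamma> (d i z)) - 2 * (a z * b z)"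
      using C(1) D(1)
    proof eventually_elim
      case (elim z)
      then show ?case
        using symmetrized_Talagrand_line[of "c i z" "d i z"] by (simp add: a_def b_def mult.assoc)
    qed
  qed (use C(2) D(2) ab R(2) in auto)
  \<comment> \<open>The mean of \<open>a z * b z\<close> factors by independence, and the mean of
    \<open>a\<close> is that of the centered component.\<close>
  also have "\<dots> = 2 * enn2real (\<integral>\<^sup>+z. rel_ent \<gamma> (c i z) \<partial>?P) + 2 * enn2real (\<integral>\<^sup>+z. rel_ent \<gamma> (d i z) \<partial>?P) - 2 * ((\<integral>z. a z \<partial>?P) * (\<integral>z. b z \<partial>?P))"
    using C(2) D(2) ab by (simp add: C(3) D(3))
  also have "(\<integral>z. a z \<partial>?P) = 0"
    unfolding a_def C(6) by (rule centered)
  finally show "(\<integral>z. (triangular_map is c z i - triangular_map (rev is) d z i)\<^sup>2 \<partial>?P) \<le>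
      2 * enn2real (\<integral>\<^sup>+z. rel_ent \<gamma> (c i z) \<partial>?P) + 2 * enn2real (\<integral>\<^sup>+z. rel_ent \<gamma> (d i z) \<partial>?P)" by simp
qed

section \<open>The Gaussian measure on the Euclidean space\<close>

lemma density_lborel_PiM:
  assumes "finite I"
  shows "density (Pi\<^sub>M I (\<lambda>_. lborel)) (\<lambda>x. \<Prod>i\<in>I. ennreal (std_normal_density (x i))) = normal_PiM I"
proof (rule \<gamma>s.PiM_eqI[OF assms])
  interpret L: product_sigma_finite "\<lambda>_. lborel :: real measure" ..
  show "sets (density (Pi\<^sub>M I (\<lambda>_. lborel)) (\<lambda>x. \<Prod>i\<in>I. ennreal (std_normal_density (x i)))) = sets (normal_PiM I)"
    unfolding sets_density by (intro sets_PiM_cong) auto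
  fix A :: "'a \<Rightarrow> real set" assume "\<And>i. i \<in> I \<Longrightarrow> A i \<in> sets \<gamma>"
  then have A[measurable]: "\<And>i. i \<in> I \<Longrightarrow> A i \<in> sets borel" by simp
  have PA: "Pi\<^sub>E I A \<in> sets (Pi\<^sub>M I (\<lambda>_. lborel))"
    using assms A by (intro sets_PiM_I_finite) auto
  have "emeasure (density (Pi\<^sub>M I (\<lambda>_. lborel)) (\<lambda>x. \<Prod>i\<in>I. ennreal (std_normal_density (x i)))) (Pi\<^sub>E I A)
    = (\<integral>\<^sup>+x. (\<Prod>i\<in>I. ennreal (std_normal_density (x i))) * indicator (Pi\<^sub>E I A) x \<partial>Pi\<^sub>M I (\<lambda>_. lborel))"
    by (rule emeasure_density[OF _ PA]) measurable
  also have "\<dots> = (\<integral>\<^sup>+x. (\<Prod>i\<in>I. ennreal (std_normal_density (x i)) * indicator (A i) (x i)) \<partial>Pi\<^sub>M I (\<lambda>_. lborel))"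
  proof (rule nn_integral_cong)
    fix x :: "'a \<Rightarrow> real" assume "x \<in> space (Pi\<^sub>M I (\<lambda>_. lborel))"
    then have "indicator (Pi\<^sub>E I A) x = (\<Prod>i\<in>I. indicator (A i) (x i) :: ennreal)"
      using assms by (auto simp: indicator_def space_PiM PiE_iff prod_zero_iff)
    then show "(\<Prod>i\<in>I. ennreal (std_normal_density (x i))) * indicator (Pi\<^sub>E I A) x =
      (\<Prod>i\<in>I. ennreal (std_normal_density (x i)) * indicator (A i) (x i))"
      by (simp add: prod.distrib)
  qed
  also have "\<dots> = (\<Prod>i\<in>I. \<integral>\<^sup>+y. ennreal (std_normal_density y) * indicator (A i) y \<partial>lborel)"
    using assms by (intro L.product_nn_integral_prod) measurable
  also have "\<dots> = (\<Prod>i\<in>I. emeasure \<gamma> (A i))"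
    by (intro prod.cong refl emeasure_density[symmetric]) auto
  finally show "emeasure (density (Pi\<^sub>M I (\<lambda>_. lborel)) (\<lambda>x. \<Prod>i\<in>I. ennreal (std_normal_density (x i)))) (Pi\<^sub>E I A)
    = (\<Prod>i\<in>I. emeasure \<gamma> (A i))" .
qed

text \<open>By \<open>lborel_eq\<close>, this is the map under which \<open>lborel\<close> is the
  image of the product of Lebesgue measures over the basis.\<close>

definition of_coords :: "('a::euclidean_space \<Rightarrow> real) \<Rightarrow> 'a" where
  "of_coords f = (\<Sum>b\<in>Basis. f b *\<^sub>R b)"

lemma of_coords_measurable [measurable]: "of_coords \<in> borel_measurable (Pi\<^sub>M Basis (\<lambda>_. borel))"
  unfolding of_coords_def[abs_def] by measurable

lemma of_coords_measurable_normal: "of_coords \<in> borel_measurable (normal_PiM Basis)"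
proof -
  have "sets (normal_PiM Basis) = sets (Pi\<^sub>M Basis (\<lambda>_. borel))" by (intro sets_PiM_cong) auto
  then show ?thesis using of_coords_measurable measurable_cong_sets by blast
qed

lemma inner_of_coords: "b \<in> Basis \<Longrightarrow> of_coords f \<bullet> b = f b"
  unfolding of_coords_def by (rule inner_sum_left_Basis)

lemma norm_of_coords_diff:
  "(norm (of_coords f - of_coords g))\<^sup>2 = (\<Sum>b\<in>Basis. (f b - g b)\<^sup>2)"
  by (subst power2_norm_eq_inner, subst euclidean_inner)
    (simp add: inner_diff_left inner_of_coords power2_eq_square)

text \<open>The squared norm is the sum of the squared coordinates, so the density is a product of
  one-dimensional ones; the normalizing constant is the \<open>CARD('n')\<close>-th power of
  \<open>1 / sqrt (2 * pi)\<close>.\<close>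

lemma std_gaussian_eq_distr:
  "(std_gaussian :: (real ^ 'n) measure) = distr (normal_PiM Basis) borel of_coords"
proof -
  let ?d = "\<lambda>x :: real ^ 'n. ennreal ((2 * pi) powr (- real CARD('n) / 2) * exp (- (norm x)\<^sup>2 / 2))"
  let ?L = "Pi\<^sub>M (Basis :: (real ^ 'n) set) (\<lambda>_. lborel)"
  have m: "of_coords \<in> measurable ?L (borel :: (real ^ 'n) measure)"
  proof -
    have "sets ?L = sets (Pi\<^sub>M Basis (\<lambda>_. borel))" by (intro sets_PiM_cong) auto
    then show ?thesis using of_coords_measurable measurable_cong_sets by blast
  qed
  have d: "?d (of_coords x) = (\<Prod>b\<in>Basis. ennreal (std_normal_density (x b)))" for x :: "real ^ 'n \<Rightarrow> real"
  proof -
    have n: "(norm (of_coords x))\<^sup>2 = (\<Sum>b\<in>Basis. (x b)\<^sup>2)"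
      using norm_of_coords_diff[of x "\<lambda>_. 0"] by (simp add: of_coords_def)
    have "(\<Prod>b\<in>(Basis :: (real ^ 'n) set). std_normal_density (x b)) = (1 / sqrt (2 * pi)) ^ CARD('n) * exp (- (\<Sum>b\<in>Basis. (x b)\<^sup>2) / 2)"
      unfolding std_normal_density_def prod.distrib prod_constant
      by (simp add: exp_sum[symmetric] sum_negf sum_divide_distrib)
    moreover have "(1 / sqrt (2 * pi)) ^ CARD('n) = (2 * pi) powr (- real CARD('n) / 2)"
    proof -
      have "1 / sqrt (2 * pi) = (2 * pi) powr (- 1 / 2)"
        by (simp add: powr_minus powr_half_sqrt inverse_eq_divide)
      then have "(1 / sqrt (2 * pi)) ^ CARD('n) = ((2 * pi) powr (- 1 / 2)) powr real CARD('n)"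
        by (subst powr_realpow) auto
      then show ?thesis by (simp add: powr_powr)
    qed
    ultimately show ?thesis
      by (subst prod_ennreal) (auto simp: n)
  qed
  have "(std_gaussian :: (real ^ 'n) measure) = density (distr ?L borel of_coords) ?d"
    unfolding std_gaussian_def of_coords_def[abs_def] lborel_eq[symmetric] ..
  also have "\<dots> = distr (density ?L (\<lambda>x. ?d (of_coords x))) borel of_coords"
    by (rule density_distr) (use m in auto)
  also have "density ?L (\<lambda>x. ?d (of_coords x)) = normal_PiM Basis"
    unfolding d by (rule density_lborel_PiM) simp
  finally show ?thesis .
qed

lemma prob_space_std_gaussian: "prob_space (std_gaussian :: (real ^ 'n) measure)"
  unfolding std_gaussian_eq_distr
  by (rule prob_space.prob_space_distr[OF prob_space_normal_PiM of_coords_measurable_normal])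

text \<open>This translates \<open>relative_entropy\<close> into \<open>rel_ent\<close>. The density
  is the Radon-Nikodym derivative, and as it has total mass 1, the affine terms of
  \<open>entropy_fun\<close> contribute 0 to the integral.\<close>

lemma relative_entropy_finiteE:
  fixes \<mu> :: "'a measure"
  assumes G: "prob_space G" and \<mu>: "prob_space \<mu>" and sets: "sets \<mu> = sets G"
    and fin: "relative_entropy \<mu> G \<noteq> \<infinity>"
  obtains f where "f \<in> borel_measurable G" "\<And>x. 0 \<le> f x" "density G f = \<mu>"
    "(\<integral>\<^sup>+x. ennreal (f x) \<partial>G) = 1" "rel_ent G f < \<infinity>" "relative_entropy \<mu> G = ereal (enn2real (rel_ent G f))"
proof -
  interpret G: prob_space G by fact
  interpret \<mu>: prob_space \<mu> by fact
  have ac: "absolutely_continuous G \<mu>" and int: "integrable \<mu> (entropy_density (exp 1) G \<mu>)"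
    and re: "relative_entropy \<mu> G = ereal (KL_divergence (exp 1) G \<mu>)"
    using fin by (auto simp: relative_entropy_def split: if_splits)
  \<comment> \<open>\<open>enn2real\<close> alters the derivative only where it is infinite, which
    is a null set because \<open>\<mu>\<close> is finite.\<close>
  define f where "f x = enn2real (RN_deriv G \<mu> x)" for x
  have f[measurable]: "f \<in> borel_measurable G" unfolding f_def by measurable
  have nonneg: "0 \<le> f x" for x by (simp add: f_def)
  have "AE x in G. RN_deriv G \<mu> x \<noteq> \<infinity>"
    using G.RN_deriv_finite[OF _ ac sets] \<mu>.sigma_finite_measure_axioms by auto
  then have "density G (\<lambda>x. ennreal (f x)) = density G (RN_deriv G \<mu>)"
    by (intro density_cong) (auto simp: f_def less_top elim!: eventually_mono)
  also have "\<dots> = \<mu>" by (rule G.density_RN_deriv[OF ac sets])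
  finally have dens: "density G f = \<mu>" .
  have total: "(\<integral>\<^sup>+x. ennreal (f x) \<partial>G) = 1"
    using \<mu>.emeasure_space_1 unfolding dens[symmetric] by (simp add: emeasure_density cong: nn_integral_cong)
  have ed: "entropy_density (exp 1) G \<mu> = (\<lambda>x. ln (f x))"
    by (auto simp: entropy_density_def f_def log_def fun_eq_iff)
  have i1: "integrable G (\<lambda>x. f x * ln (f x))"
    using int unfolding ed by (subst (asm) dens[symmetric], subst (asm) integrable_density) (auto simp: nonneg)
  have i2: "integrable G f"
    using total nonneg by (intro integrableI_nonneg) auto
  have I2: "(\<integral>x. f x \<partial>G) = 1"
    using total nonneg by (subst integral_eq_nn_integral) auto
  have KL: "KL_divergence (exp 1) G \<mu> = (\<integral>x. f x * ln (f x) \<partial>G)"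
    unfolding KL_divergence_def ed
    by (subst dens[symmetric], subst integral_density) (auto simp: nonneg)
  have i3: "integrable G (\<lambda>x. entropy_fun (f x))"
    unfolding entropy_fun_def using i1 i2 by simp
  have "(\<integral>x. entropy_fun (f x) \<partial>G) = KL_divergence (exp 1) G \<mu>"
    unfolding entropy_fun_def KL using i1 i2 by (simp add: I2 G.prob_space)
  then have r: "rel_ent G f = ennreal (KL_divergence (exp 1) G \<mu>)"
    unfolding rel_ent_def using nn_integral_eq_integral[OF i3] nonneg by (simp add: entropy_fun_nonneg)
  have "0 \<le> (\<integral>x. entropy_fun (f x) \<partial>G)"
    using nonneg by (intro Bochner_Integration.integral_nonneg) (simp add: entropy_fun_nonneg)
  then have "0 \<le> KL_divergence (exp 1) G \<mu>" by (simp add: \<open>_ = KL_divergence (exp 1) G \<mu>\<close>)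
  then show ?thesis
    using f nonneg dens total r re by (intro that[of f]) auto
qed

text \<open>The Knothe rearrangement is transported along \<open>of_coords\<close>, and the moments
  of the components are read off from the law \<open>\<mu>\<close>. The order of the basis is left
  free, so that an order and its reverse can both be used.\<close>

lemma gaussian_Knothe_map:
  fixes \<mu> :: "(real ^ 'n) measure" and "is" :: "(real ^ 'n) list"
  assumes \<mu>: "prob_space \<mu>" "sets \<mu> = sets borel" and fin: "relative_entropy \<mu> std_gaussian \<noteq> \<infinity>"
    and "is": "distinct is" "set is = Basis"
    and sq: "integrable \<mu> (\<lambda>x. (norm x)\<^sup>2)"
  obtains c where "triangular is c"
    "distr (normal_PiM Basis) borel (\<lambda>z. of_coords (triangular_map is c z)) = \<mu>"
    "ereal (enn2real (\<Sum>b\<in>Basis. \<integral>\<^sup>+z. rel_ent \<gamma> (c b z) \<partial>normal_PiM Basis)) \<le> relative_entropy \<mu> std_gaussian"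
    "(\<Sum>b\<in>Basis. \<integral>\<^sup>+z. rel_ent \<gamma> (c b z) \<partial>normal_PiM Basis) < \<infinity>"
    "\<And>b. b \<in> Basis \<Longrightarrow> integrable (normal_PiM Basis) (\<lambda>z. (triangular_map is c z b)\<^sup>2)"
    "\<And>b. b \<in> Basis \<Longrightarrow> (\<integral>z. triangular_map is c z b \<partial>normal_PiM Basis) = (\<integral>x. x \<partial>\<mu>) \<bullet> b"
proof -
  let ?P = "normal_PiM (Basis :: (real ^ 'n) set)"
  let ?G = "std_gaussian :: (real ^ 'n) measure"
  have sG: "sets \<mu> = sets ?G" using \<mu> by (simp add: std_gaussian_def)
  obtain f where f: "f \<in> borel_measurable ?G" "\<And>x. 0 \<le> f x" "density ?G f = \<mu>"
    "(\<integral>\<^sup>+x. ennreal (f x) \<partial>?G) = 1" "rel_ent ?G f < \<infinity>" "relative_entropy \<mu> ?G = ereal (enn2real (rel_ent ?G f))"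
    using relative_entropy_finiteE[OF prob_space_std_gaussian \<mu>(1) sG fin] by metis
  have fb[measurable]: "f \<in> borel_measurable borel" using f(1) by (simp add: std_gaussian_def)
  note oc[measurable] = of_coords_measurable_normal
  define g where "g = (\<lambda>z. f (of_coords z))"
  have g: "g \<in> borel_measurable ?P" unfolding g_def by measurable
  have "(\<integral>\<^sup>+z. ennreal (g z) \<partial>?P) = 1"
    using f(4) unfolding std_gaussian_eq_distr g_def by (subst (asm) nn_integral_distr) auto
  then obtain c where c: "triangular is c"
    "distr ?P ?P (triangular_map is c) = density ?P g"
    "(\<Sum>b\<in>Basis. \<integral>\<^sup>+z. rel_ent \<gamma> (c b z) \<partial>?P) \<le> rel_ent ?P g"
    using Knothe_rearrangement[of "is" g] "is" g f(2) by (auto simp: g_def)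
  have S: "triangular_map is c \<in> measurable ?P ?P"
    using triangular_map_measurable[OF c(1)] "is" by simp
  have rG: "rel_ent ?P g = rel_ent ?G f"
    unfolding std_gaussian_eq_distr rel_ent_def g_def by (subst nn_integral_distr) auto
  have "distr ?P borel (\<lambda>z. of_coords (triangular_map is c z)) = distr (distr ?P ?P (triangular_map is c)) borel of_coords"
    using distr_distr[OF oc S] by (simp add: comp_def)
  also have "\<dots> = density (distr ?P borel of_coords) f"
    unfolding c(2) g_def by (rule density_distr[symmetric]) auto
  also have "\<dots> = \<mu>"
    using f(3) unfolding std_gaussian_eq_distr .
  finally have law: "distr ?P borel (\<lambda>z. of_coords (triangular_map is c z)) = \<mu>" .
  have mS: "(\<lambda>z. of_coords (triangular_map is c z)) \<in> borel_measurable ?P"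
    using measurable_comp[OF S oc] by (simp add: comp_def)
  interpret \<mu>: prob_space \<mu> by fact
  show ?thesis
  proof (rule that[OF c(1) law])
    show "ereal (enn2real (\<Sum>b\<in>Basis. \<integral>\<^sup>+z. rel_ent \<gamma> (c b z) \<partial>?P)) \<le> relative_entropy \<mu> ?G"
      unfolding f(6) using c(3) f(5) by (simp add: rG enn2real_mono)
    show "(\<Sum>b\<in>Basis. \<integral>\<^sup>+z. rel_ent \<gamma> (c b z) \<partial>?P) < \<infinity>"
      using c(3) f(5) rG by (simp add: le_less_trans)
    fix b :: "real ^ 'n" assume b: "b \<in> Basis"
    have [measurable]: "(\<lambda>x. x \<bullet> b) \<in> borel_measurable borel" by measurable
    have sq_b: "integrable \<mu> (\<lambda>x. (x \<bullet> b)\<^sup>2)"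
    proof (rule Bochner_Integration.integrable_bound[OF sq])
      show "(\<lambda>x. (x \<bullet> b)\<^sup>2) \<in> borel_measurable \<mu>"
        unfolding measurable_cong_sets[OF \<mu>(2) refl] by measurable
      have "(x \<bullet> b)\<^sup>2 \<le> (norm x)\<^sup>2" for x
        using Basis_le_norm[OF b, of x] by (metis abs_le_square_iff abs_norm_cancel)
      then show "AE x in \<mu>. norm ((x \<bullet> b)\<^sup>2) \<le> norm ((norm x)\<^sup>2)" by simp
    qed
    then show "integrable ?P (\<lambda>z. (triangular_map is c z b)\<^sup>2)"
      by (subst (asm) law[symmetric], subst (asm) integrable_distr_eq[OF mS]) (auto simp: inner_of_coords b)
    have "integrable \<mu> (\<lambda>x. norm x)"
      by (rule \<mu>.square_integrable_imp_integrable[OF _ sq]) (unfold measurable_cong_sets[OF \<mu>(2) refl], measurable)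
    then have int: "integrable \<mu> (\<lambda>x. x)"
      by (subst (asm) integrable_norm_iff) (unfold measurable_cong_sets[OF \<mu>(2) refl], measurable)
    have "(\<integral>z. triangular_map is c z b \<partial>?P) = (\<integral>x. x \<bullet> b \<partial>\<mu>)"
      by (subst law[symmetric], subst integral_distr[OF mS]) (auto simp: inner_of_coords b)
    also have "\<dots> = (\<integral>x. x \<partial>\<mu>) \<bullet> b"
      using int by simp
    finally show "(\<integral>z. triangular_map is c z b \<partial>?P) = (\<integral>x. x \<partial>\<mu>) \<bullet> b" .
  qed
qed

section \<open>The bound on the Wasserstein distance\<close>

lemma W2_le:
  assumes "P \<in> couplings \<mu> \<nu>" and "(\<integral>\<^sup>+(x, y). ennreal ((norm (x - y))\<^sup>2) \<partial>P) \<le> ennreal R" and "0 \<le> R"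
  shows "(W2 \<mu> \<nu>)\<^sup>2 \<le> ereal R"
proof -
  have le: "transport_cost2 \<mu> \<nu> \<le> ennreal R"
    unfolding transport_cost2_def using assms(1,2) by (rule INF_lower2)
  then have "transport_cost2 \<mu> \<nu> \<noteq> \<infinity>" by (auto simp: top_unique)
  then have "(W2 \<mu> \<nu>)\<^sup>2 = ereal (enn2real (transport_cost2 \<mu> \<nu>))"
    by (simp add: W2_def)
  also have "\<dots> \<le> ereal R"
    using le assms(3) by (simp add: enn2real_leI)
  finally show ?thesis .
qed

theorem theorem1:
  fixes \<mu> \<nu> :: "(real ^ 'n) measure"
  assumes "prob_space \<mu>" and "sets \<mu> = sets borel"
    and "prob_space \<nu>" and "sets \<nu> = sets borel"
    and "integrable \<mu> (\<lambda>x. (norm x)\<^sup>2)"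
    and "integrable \<nu> (\<lambda>x. (norm x)\<^sup>2)"
    and "(\<integral>x. x \<partial>\<mu>) = 0"
  shows "(W2 \<mu> \<nu>)\<^sup>2 \<le> 2 * relative_entropy \<mu> std_gaussian + 2 * relative_entropy \<nu> std_gaussian"
proof (cases "relative_entropy \<mu> std_gaussian = \<infinity> \<or> relative_entropy \<nu> std_gaussian = \<infinity>")
  case True
  \<comment> \<open>One infinite entropy makes the right-hand side infinite, since neither entropy
    is \<open>- \<infinity>\<close>.\<close>
  have inf: "2 * a + 2 * b = \<infinity>" if "a = \<infinity> \<or> b = \<infinity>" "a \<noteq> - \<infinity>" "b \<noteq> - \<infinity>" for a b :: ereal
    using that by (cases a; cases b) auto
  have "2 * relative_entropy \<mu> std_gaussian + 2 * relative_entropy \<nu> std_gaussian = \<infinity>"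
    by (rule inf[OF True]) (simp_all add: relative_entropy_def)
  then show ?thesis by (simp only: ereal_less_eq(1))
next
  case False
  let ?B = "Basis :: (real ^ 'n) set"
  let ?P = "normal_PiM ?B"
  obtain "is" where "is": "distinct is" "set is = ?B"
    using finite_distinct_list[OF finite_Basis] by metis
  obtain c where c: "triangular is c"
    "distr ?P borel (\<lambda>z. of_coords (triangular_map is c z)) = \<mu>"
    "ereal (enn2real (\<Sum>b\<in>?B. \<integral>\<^sup>+z. rel_ent \<gamma> (c b z) \<partial>?P)) \<le> relative_entropy \<mu> std_gaussian"
    "(\<Sum>b\<in>?B. \<integral>\<^sup>+z. rel_ent \<gamma> (c b z) \<partial>?P) < \<infinity>"
    "\<And>b. b \<in> ?B \<Longrightarrow> integrable ?P (\<lambda>z. (triangular_map is c z b)\<^sup>2)"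
    "\<And>b. b \<in> ?B \<Longrightarrow> (\<integral>z. triangular_map is c z b \<partial>?P) = (\<integral>x. x \<partial>\<mu>) \<bullet> b"
    using gaussian_Knothe_map[OF assms(1,2) _ "is" assms(5)] False by blast
  \<comment> \<open>The second map runs through the basis in reverse, so that the coordinates
    preceding \<open>b\<close> for one map are those following it for the other.\<close>
  have ris: "distinct (rev is)" "set (rev is) = ?B" using "is" by auto
  obtain d where d: "triangular (rev is) d"
    "distr ?P borel (\<lambda>z. of_coords (triangular_map (rev is) d z)) = \<nu>"
    "ereal (enn2real (\<Sum>b\<in>?B. \<integral>\<^sup>+z. rel_ent \<gamma> (d b z) \<partial>?P)) \<le> relative_entropy \<nu> std_gaussian"
    "(\<Sum>b\<in>?B. \<integral>\<^sup>+z. rel_ent \<gamma> (d b z) \<partial>?P) < \<infinity>"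
    "\<And>b. b \<in> ?B \<Longrightarrow> integrable ?P (\<lambda>z. (triangular_map (rev is) d z b)\<^sup>2)"
    "\<And>b. b \<in> ?B \<Longrightarrow> (\<integral>z. triangular_map (rev is) d z b \<partial>?P) = (\<integral>x. x \<partial>\<nu>) \<bullet> b"
    using gaussian_Knothe_map[OF assms(3,4) _ ris assms(6)] False by blast
  define S where "S = triangular_map is c"
  define T where "T = triangular_map (rev is) d"
  define ec where "ec b = (\<integral>\<^sup>+z. rel_ent \<gamma> (c b z) \<partial>?P)" for b
  define ed where "ed b = (\<integral>\<^sup>+z. rel_ent \<gamma> (d b z) \<partial>?P)" for b
  have fin: "ec b < \<infinity>" "ed b < \<infinity>" if "b \<in> ?B" for b
    using c(4) d(4) that by (auto simp: ec_def[symmetric] ed_def[symmetric] less_top)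
  have coord: "integrable ?P (\<lambda>z. (S z b - T z b)\<^sup>2)"
    "(\<integral>z. (S z b - T z b)\<^sup>2 \<partial>?P) \<le> 2 * enn2real (ec b) + 2 * enn2real (ed b)" if b: "b \<in> ?B" for b
    using symmetrized_Talagrand_coordinate[OF "is"(1) _ c(1) d(1), unfolded "is"(2), OF b c(5)[OF b] d(5)[OF b]]
      fin[OF b] c(6)[OF b] assms(7) unfolding S_def T_def ec_def ed_def by auto
  have ms: "S \<in> measurable ?P ?P" "T \<in> measurable ?P ?P"
    using triangular_map_measurable[OF c(1)] triangular_map_measurable[OF d(1)] "is" by (simp_all add: S_def T_def)
  have [measurable]: "(\<lambda>z. of_coords (S z)) \<in> borel_measurable ?P" "(\<lambda>z. of_coords (T z)) \<in> borel_measurable ?P"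
    using measurable_comp[OF _ of_coords_measurable_normal] ms by (simp_all add: comp_def)
  let ?ST = "\<lambda>z. (of_coords (S z), of_coords (T z))"
  \<comment> \<open>The coupling is the joint law of the two maps applied to the same Gaussian
    point.\<close>
  define Q where "Q = distr ?P (borel \<Otimes>\<^sub>M borel) ?ST"
  have m: "?ST \<in> measurable ?P (borel \<Otimes>\<^sub>M borel)" by measurable
  have "distr Q borel fst = distr ?P borel (\<lambda>z. of_coords (S z))"
    unfolding Q_def by (subst distr_distr[OF measurable_fst m]) (simp add: comp_def)
  moreover have "distr Q borel snd = distr ?P borel (\<lambda>z. of_coords (T z))"
    unfolding Q_def by (subst distr_distr[OF measurable_snd m]) (simp add: comp_def)
  moreover have "prob_space Q"
    unfolding Q_def by (rule prob_space.prob_space_distr[OF prob_space_normal_PiM m])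
  moreover have "sets Q = sets (borel \<Otimes>\<^sub>M borel)"
    by (simp add: Q_def)
  ultimately have Q: "Q \<in> couplings \<mu> \<nu>"
    using c(2) d(2) by (simp add: couplings_def S_def T_def)
  define R where "R = (\<Sum>b\<in>?B. 2 * enn2real (ec b) + 2 * enn2real (ed b))"
  \<comment> \<open>The squared Euclidean distance is a sum over the coordinates, so the coordinate
    bounds can be added up.\<close>
  have "(\<integral>\<^sup>+(x, y). ennreal ((norm (x - y))\<^sup>2) \<partial>Q) = (\<integral>\<^sup>+z. ennreal (\<Sum>b\<in>?B. (S z b - T z b)\<^sup>2) \<partial>?P)"
    unfolding Q_def by (subst nn_integral_distr[OF m]) (auto simp: norm_of_coords_diff)
  also have "\<dots> = ennreal (\<integral>z. (\<Sum>b\<in>?B. (S z b - T z b)\<^sup>2) \<partial>?P)"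
    by (intro nn_integral_eq_integral Bochner_Integration.integrable_sum coord(1) AE_I2 sum_nonneg) auto
  also have "\<dots> \<le> ennreal R"
    unfolding R_def using coord by (intro ennreal_leI) (auto simp: intro!: sum_mono)
  finally have "(W2 \<mu> \<nu>)\<^sup>2 \<le> ereal R"
    by (intro W2_le[OF Q]) (auto simp: R_def intro!: sum_nonneg)
  also have "R = 2 * enn2real (\<Sum>b\<in>?B. ec b) + 2 * enn2real (\<Sum>b\<in>?B. ed b)"
    unfolding R_def using fin by (simp add: enn2real_sum sum.distrib sum_distrib_left less_top)
  also have "ereal \<dots> = 2 * ereal (enn2real (\<Sum>b\<in>?B. ec b)) + 2 * ereal (enn2real (\<Sum>b\<in>?B. ed b))"
    by simp
  also have "\<dots> \<le> 2 * relative_entropy \<mu> std_gaussian + 2 * relative_entropy \<nu> std_gaussian"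
    using c(3) d(3) unfolding ec_def[symmetric] ed_def[symmetric]
    by (intro add_mono ereal_mult_left_mono) auto
  finally show ?thesis .
qed

end
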